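(* Let $(\mathfrak g,B,\omega)$ be a non-null odd-quadratic even-symplectic Lie superalgebra. Then $\mathfrak g$ is obtained from $\{0\}$ by a finite sequence of generalized odd double extensions by the two-dimensional abelian Lie superalgebra.
   Context: All Lie superalgebras are finite dimensional over an algebraically closed field $\mathbb K$ of characteristic zero; $|x|\in\mathbb Z_2$ is the degree of a homogeneous $X$; "non-null" means nonzero. A bilinear form $\theta$ is even if $\theta(\mathfrak g_\alpha,\mathfrak g_\beta)=\{0\}$ for $\alpha\ne\beta$, odd if $\theta(\mathfrak g_\alpha,\mathfrak g_\alpha)=\{0\}$ for all $\alpha$. An odd-invariant scalar product $B$ is an odd, supersymmetric ($B(X,Y)=(-1)^{|x||y|}B(Y,X)$), invariant ($B([X,Y],Z)=B(X,[Y,Z])$), non-degenerate bilinear form. An even-symplectic form is an even, skew-supersymmetric ($\omega(X,Y)=-(-1)^{|x||y|}\omega(Y,X)$), non-degenerate form with $(-1)^{|z||x|}\omega(X,[Y,Z])+(-1)^{|x||y|}\omega(Y,[Z,X])+(-1)^{|y||z|}\omega(Z,[X,Y])=0$. An odd-quadratic even-symplectic Lie superalgebra $(\mathfrak g,B,\omega)$ carries both; then there is a unique odd invertible superderivation $\delta$ with $\omega(X,Y)=B(\delta(X),Y)$, and it is skew-supersymmetric. A superderivation $\Delta$ of degree $d$ satisfies $\Delta(\mathfrak g_\alpha)\subseteq \mathfrak g_{\alpha+d}$ and $\Delta[X,Y]=[\Delta(X),Y]+(-1)^{d|x|}[X,\Delta(Y)]$; it is skew-supersymmetric for $B$ if $B(\Delta(X),Y)=-(-1)^{d|x|}B(X,\Delta(Y))$.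 Brackets of endomorphisms are supercommutators. Generalized odd double extension by the two-dimensional abelian Lie superalgebra $\mathbb Ke_0\oplus\mathbb Ke_1$ ($e_0$ even, $e_1$ odd). Let $(\mathfrak h,B,\omega)$ be odd-quadratic even-symplectic with associated odd invertible superderivation $\delta$. Let $D$ (even), $\bar D$ (odd) be skew-supersymmetric superderivations of $(\mathfrak h,B)$, $x_0,c_0\in\mathfrak h_{\bar0}$, $x_1,c_1\in\mathfrak h_{\bar1}$, $k,\alpha\in\mathbb K$, $\lambda\in\mathbb K\setminus\{0\}$ with $\bar D^2=\frac12\mathrm{ad}(x_0)$, $\bar D(x_0)=0$, $[D,\bar D]=\mathrm{ad}(x_1)$, $D(x_0)=2\bar D(x_1)$, $B(x_0,x_1)=0$, and $\mathrm{ad}(c_0)=[\delta,\bar D]-\lambda D$, $\mathrm{ad}(c_1)=[\delta,D]+\lambda\bar D$, $\delta(x_0)=-2\bar D(c_0)+2\lambda x_1$, $\delta(x_1)=D(c_0)+\bar D(c_1)-\lambda x_0$, $\lambda k=B(c_1,x_0)-2B(x_1,c_0)$. On $\mathfrak t=\mathbb Ke_0^*\oplus\mathbb Ke_1^*\oplus\mathfrak h\oplus\mathbb Ke_0\oplus\mathbb Ke_1$ ($e_0^*$ even, $e_1^*$ odd, both central) put $[X,Y]=[X,Y]_{\mathfrak h}+B(\bar D(X),Y)e_0^*+B(D(X),Y)e_1^*$, $[e_0,X]=D(X)-B(x_1,X)e_0^*$, $[e_1,X]=\bar D(X)+B(x_0,X)e_0^*+B(x_1,X)e_1^*$, $[e_0,e_1]=x_1$,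 $[e_1,e_1]=ke_0^*+x_0$, $[e_0,e_0]=0$; let $\gamma$ be the supersymmetric form with $\gamma|_{\mathfrak h\times\mathfrak h}=B$, $\gamma(e_0^*,e_1)=1=\gamma(e_1^*,e_0)$, other pairings zero; let $\Delta(e_0^* )=\lambda e_1^*$, $\Delta(e_1^* )=\lambda e_0^*$, $\Delta(e_0)=c_1-\lambda e_1$, $\Delta(e_1)=\alpha e_0^*+c_0+\lambda e_0$, $\Delta(X)=B(c_0,X)e_0^*+\delta(X)-B(c_1,X)e_1^*$. Then $(\mathfrak t,\gamma,\Omega)$ with $\Omega(X,Y)=\gamma(\Delta(X),Y)$ is an odd-quadratic even-symplectic Lie superalgebra, called the generalized odd double extension of $(\mathfrak h,B,\omega)$ by the two-dimensional abelian Lie superalgebra. "Is obtained" is up to isomorphism preserving both forms. *)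

theory Defs
  imports
    "HOL-Library.Z2"
    "HOL-Library.Product_Plus"
    "HOL-Computational_Algebra.Computational_Algebra"
begin

section \<open>Super vector spaces\<close>

text \<open>
  Degrees are elements of \<^typ>\<open>bit\<close>, the field with two elements.  A super vector space is
  given by its homogeneous parts, two independent subspaces of an ambient vector space which
  need not be all of the ambient type.  Maps and forms are whole functions on that type; only
  their values on \<open>whole V\<close> matter.
\<close>

definition whole :: "(bit \<Rightarrow> 'v::ab_group_add set) \<Rightarrow> 'v set" where
  "whole V = {x + y | x y. x \<in> V 0 \<and> y \<in> V 1}"

text \<open>\<open>(-1)\<^sup>a\<close> for \<open>a\<close> in \<open>\<int>/2\<close>; the usual sign rule is \<open>msgn (a * b)\<close>.\<close>

definition msgn :: "bit \<Rightarrow> 'k::field" where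
  "msgn a = (if a = 0 then 1 else - 1)"

locale super_space = vector_space scale
  for scale :: "'k::field \<Rightarrow> 'v::ab_group_add \<Rightarrow> 'v" +
  fixes V :: "bit \<Rightarrow> 'v set"
  assumes subspace_part: "subspace (V a)"
    and independent_parts: "V 0 \<inter> V 1 = {0}"
    and finite_dim: "\<exists>S. finite S \<and> whole V \<subseteq> span S"

definition linear_on ::
  "('k \<Rightarrow> 'v \<Rightarrow> 'v) \<Rightarrow> ('k \<Rightarrow> 'w \<Rightarrow> 'w) \<Rightarrow> 'v::ab_group_add set \<Rightarrow> ('v \<Rightarrow> 'w::ab_group_add) \<Rightarrow> bool" where
  "linear_on s s' A f \<longleftrightarrow>
     (\<forall>x\<in>A. \<forall>y\<in>A. f (x + y) = f x + f y) \<and> (\<forall>c. \<forall>x\<in>A. f (s c x) = s' c (f x))"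

definition bilinear_on ::
  "('k \<Rightarrow> 'v \<Rightarrow> 'v) \<Rightarrow> ('k \<Rightarrow> 'w \<Rightarrow> 'w) \<Rightarrow> 'v::ab_group_add set
     \<Rightarrow> ('v \<Rightarrow> 'v \<Rightarrow> 'w::ab_group_add) \<Rightarrow> bool" where
  "bilinear_on s s' A f \<longleftrightarrow>
     (\<forall>x\<in>A. linear_on s s' A (f x)) \<and> (\<forall>y\<in>A. linear_on s s' A (\<lambda>x. f x y))"

text \<open>\<open>hpart V a x\<close> is the component of degree \<open>a\<close> of \<open>x\<close>, and \<open>parity_inv V x\<close> is
  \<open>(-1)\<^sup>|\<^sup>x\<^sup>| x\<close>, extended linearly.\<close>

definition hpart :: "(bit \<Rightarrow> 'v::ab_group_add set) \<Rightarrow> bit \<Rightarrow> 'v \<Rightarrow> 'v" where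
  "hpart V a x = (THE y. y \<in> V a \<and> x - y \<in> V (a + 1))"

definition parity_inv :: "(bit \<Rightarrow> 'v::ab_group_add set) \<Rightarrow> 'v \<Rightarrow> 'v" where
  "parity_inv V x = hpart V 0 x - hpart V 1 x"


section \<open>Lie superalgebras and bilinear forms\<close>

locale lie_superalgebra = super_space scale V
  for scale :: "'k::field \<Rightarrow> 'v::ab_group_add \<Rightarrow> 'v" and V :: "bit \<Rightarrow> 'v set" +
  fixes br :: "'v \<Rightarrow> 'v \<Rightarrow> 'v"
  assumes br_bilinear: "bilinear_on scale scale (whole V) br"
    and br_graded: "\<lbrakk>x \<in> V a; y \<in> V b\<rbrakk> \<Longrightarrow> br x y \<in> V (a + b)"
    and br_skew: "\<lbrakk>x \<in> V a; y \<in> V b\<rbrakk> \<Longrightarrow> br x y = - scale (msgn (a * b)) (br y x)"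
    and br_jacobi: "\<lbrakk>x \<in> V a; y \<in> V b; z \<in> V c\<rbrakk> \<Longrightarrow>
      scale (msgn (a * c)) (br x (br y z)) + scale (msgn (a * b)) (br y (br z x))
        + scale (msgn (b * c)) (br z (br x y)) = 0"

definition bilinear_form ::
  "('k::field \<Rightarrow> 'v \<Rightarrow> 'v) \<Rightarrow> (bit \<Rightarrow> 'v::ab_group_add set) \<Rightarrow> ('v \<Rightarrow> 'v \<Rightarrow> 'k) \<Rightarrow> bool" where
  "bilinear_form s V \<theta> \<longleftrightarrow> bilinear_on s (*) (whole V) \<theta>"

definition even_form :: "(bit \<Rightarrow> 'v set) \<Rightarrow> ('v \<Rightarrow> 'v \<Rightarrow> 'k::field) \<Rightarrow> bool" where
  "even_form V \<theta> \<longleftrightarrow> (\<forall>a b. a \<noteq> b \<longrightarrow> (\<forall>x\<in>V a. \<forall>y\<in>V b. \<theta> x y = 0))"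

definition odd_form :: "(bit \<Rightarrow> 'v set) \<Rightarrow> ('v \<Rightarrow> 'v \<Rightarrow> 'k::field) \<Rightarrow> bool" where
  "odd_form V \<theta> \<longleftrightarrow> (\<forall>a. \<forall>x\<in>V a. \<forall>y\<in>V a. \<theta> x y = 0)"

definition supersymmetric :: "(bit \<Rightarrow> 'v set) \<Rightarrow> ('v \<Rightarrow> 'v \<Rightarrow> 'k::field) \<Rightarrow> bool" where
  "supersymmetric V \<theta> \<longleftrightarrow> (\<forall>a b. \<forall>x\<in>V a. \<forall>y\<in>V b. \<theta> x y = msgn (a * b) * \<theta> y x)"

definition skew_supersymmetric :: "(bit \<Rightarrow> 'v set) \<Rightarrow> ('v \<Rightarrow> 'v \<Rightarrow> 'k::field) \<Rightarrow> bool" where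
  "skew_supersymmetric V \<theta> \<longleftrightarrow> (\<forall>a b. \<forall>x\<in>V a. \<forall>y\<in>V b. \<theta> x y = - (msgn (a * b) * \<theta> y x))"

definition nondegenerate :: "(bit \<Rightarrow> 'v::ab_group_add set) \<Rightarrow> ('v \<Rightarrow> 'v \<Rightarrow> 'k::field) \<Rightarrow> bool" where
  "nondegenerate V \<theta> \<longleftrightarrow> (\<forall>x\<in>whole V. (\<forall>y\<in>whole V. \<theta> x y = 0) \<longrightarrow> x = 0)"

definition invariant_form ::
  "(bit \<Rightarrow> 'v::ab_group_add set) \<Rightarrow> ('v \<Rightarrow> 'v \<Rightarrow> 'v) \<Rightarrow> ('v \<Rightarrow> 'v \<Rightarrow> 'k::field) \<Rightarrow> bool" where
  "invariant_form V br \<theta> \<longleftrightarrow>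
     (\<forall>x\<in>whole V. \<forall>y\<in>whole V. \<forall>z\<in>whole V. \<theta> (br x y) z = \<theta> x (br y z))"

definition closed_form ::
  "(bit \<Rightarrow> 'v set) \<Rightarrow> ('v \<Rightarrow> 'v \<Rightarrow> 'v) \<Rightarrow> ('v \<Rightarrow> 'v \<Rightarrow> 'k::field) \<Rightarrow> bool" where
  "closed_form V br \<theta> \<longleftrightarrow> (\<forall>a b c. \<forall>x\<in>V a. \<forall>y\<in>V b. \<forall>z\<in>V c.
     msgn (c * a) * \<theta> x (br y z) + msgn (a * b) * \<theta> y (br z x) + msgn (b * c) * \<theta> z (br x y) = 0)"

definition odd_invariant_scalar_product ::
  "('k::field \<Rightarrow> 'v \<Rightarrow> 'v) \<Rightarrow> (bit \<Rightarrow> 'v::ab_group_add set) \<Rightarrow> ('v \<Rightarrow> 'v \<Rightarrow> 'v)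
     \<Rightarrow> ('v \<Rightarrow> 'v \<Rightarrow> 'k) \<Rightarrow> bool" where
  "odd_invariant_scalar_product s V br B \<longleftrightarrow>
     bilinear_form s V B \<and> odd_form V B \<and> supersymmetric V B \<and> invariant_form V br B
       \<and> nondegenerate V B"

definition even_symplectic_form ::
  "('k::field \<Rightarrow> 'v \<Rightarrow> 'v) \<Rightarrow> (bit \<Rightarrow> 'v::ab_group_add set) \<Rightarrow> ('v \<Rightarrow> 'v \<Rightarrow> 'v)
     \<Rightarrow> ('v \<Rightarrow> 'v \<Rightarrow> 'k) \<Rightarrow> bool" where
  "even_symplectic_form s V br \<omega> \<longleftrightarrow>
     bilinear_form s V \<omega> \<and> even_form V \<omega> \<and> skew_supersymmetric V \<omega> \<and> nondegenerate V \<omega>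
       \<and> closed_form V br \<omega>"

record ('k, 'v) qs_superalgebra =
  part :: "bit \<Rightarrow> 'v set"
  bracket :: "'v \<Rightarrow> 'v \<Rightarrow> 'v"
  bform :: "'v \<Rightarrow> 'v \<Rightarrow> 'k"
  sform :: "'v \<Rightarrow> 'v \<Rightarrow> 'k"

definition odd_quadratic_even_symplectic ::
  "('k::field \<Rightarrow> 'v \<Rightarrow> 'v) \<Rightarrow> ('k, 'v::ab_group_add) qs_superalgebra \<Rightarrow> bool" where
  "odd_quadratic_even_symplectic s G \<longleftrightarrow>
     lie_superalgebra s (part G) (bracket G)
     \<and> odd_invariant_scalar_product s (part G) (bracket G) (bform G)
     \<and> even_symplectic_form s (part G) (bracket G) (sform G)"

definition null_superalgebra :: "('k::field, 'v::ab_group_add) qs_superalgebra" where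
  "null_superalgebra =
     \<lparr>part = (\<lambda>a. {0}), bracket = (\<lambda>x y. 0), bform = (\<lambda>x y. 0), sform = (\<lambda>x y. 0)\<rparr>"

definition qs_isomorphism ::
  "('k::field \<Rightarrow> 'v \<Rightarrow> 'v) \<Rightarrow> ('k, 'v::ab_group_add) qs_superalgebra
     \<Rightarrow> ('k \<Rightarrow> 'w \<Rightarrow> 'w) \<Rightarrow> ('k, 'w::ab_group_add) qs_superalgebra \<Rightarrow> ('v \<Rightarrow> 'w) \<Rightarrow> bool" where
  "qs_isomorphism s G s' G' \<phi> \<longleftrightarrow>
     linear_on s s' (whole (part G)) \<phi>
     \<and> bij_betw \<phi> (whole (part G)) (whole (part G'))
     \<and> (\<forall>a. \<phi> ` part G a \<subseteq> part G' a)
     \<and> (\<forall>x\<in>whole (part G). \<forall>y\<in>whole (part G).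
          \<phi> (bracket G x y) = bracket G' (\<phi> x) (\<phi> y)
          \<and> bform G' (\<phi> x) (\<phi> y) = bform G x y
          \<and> sform G' (\<phi> x) (\<phi> y) = sform G x y)"


section \<open>Superderivations\<close>

definition superderivation ::
  "('k::field \<Rightarrow> 'v \<Rightarrow> 'v) \<Rightarrow> (bit \<Rightarrow> 'v::ab_group_add set) \<Rightarrow> ('v \<Rightarrow> 'v \<Rightarrow> 'v) \<Rightarrow> bit
     \<Rightarrow> ('v \<Rightarrow> 'v) \<Rightarrow> bool" where
  "superderivation s V br d f \<longleftrightarrow>
     linear_on s s (whole V) f
     \<and> (\<forall>a. f ` V a \<subseteq> V (a + d))
     \<and> (\<forall>a b. \<forall>x\<in>V a. \<forall>y\<in>V b. f (br x y) = br (f x) y + s (msgn (d * a)) (br x (f y)))"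

definition skew_supersymmetric_map ::
  "(bit \<Rightarrow> 'v set) \<Rightarrow> ('v \<Rightarrow> 'v \<Rightarrow> 'k::field) \<Rightarrow> bit \<Rightarrow> ('v \<Rightarrow> 'v) \<Rightarrow> bool" where
  "skew_supersymmetric_map V B d f \<longleftrightarrow>
     (\<forall>a b. \<forall>x\<in>V a. \<forall>y\<in>V b. B (f x) y = - (msgn (d * a) * B x (f y)))"

text \<open>The supercommutator of endomorphisms \<open>f\<close>, \<open>g\<close> of degrees \<open>d\<close>, \<open>d'\<close>.\<close>

definition supercomm ::
  "('k::field \<Rightarrow> 'v \<Rightarrow> 'v) \<Rightarrow> bit \<Rightarrow> bit \<Rightarrow> ('v \<Rightarrow> 'v) \<Rightarrow> ('v \<Rightarrow> 'v) \<Rightarrow> 'v::ab_group_add \<Rightarrow> 'v" where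
  "supercomm s d d' f g x = f (g x) - s (msgn (d * d')) (g (f x))"

definition associated_superderivation ::
  "('k::field \<Rightarrow> 'v \<Rightarrow> 'v) \<Rightarrow> ('k, 'v::ab_group_add) qs_superalgebra \<Rightarrow> ('v \<Rightarrow> 'v) \<Rightarrow> bool" where
  "associated_superderivation s H \<delta> \<longleftrightarrow>
     superderivation s (part H) (bracket H) 1 \<delta>
     \<and> bij_betw \<delta> (whole (part H)) (whole (part H))
     \<and> (\<forall>x\<in>whole (part H). \<forall>y\<in>whole (part H). sform H x y = bform H (\<delta> x) y)"


section \<open>Generalized odd double extensions\<close>

text \<open>
  The parameters of an extension; \<open>eDb\<close> is \<open>D\<close> with a bar, \<open>ek\<close>, \<open>ealpha\<close>, \<open>elam\<close> are the scalars
  \<open>k\<close>, \<open>\<alpha>\<close>, \<open>\<lambda>\<close>.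
\<close>

record ('k, 'v) ext_data =
  eD :: "'v \<Rightarrow> 'v"
  eDb :: "'v \<Rightarrow> 'v"
  ex0 :: 'v
  ex1 :: 'v
  ec0 :: 'v
  ec1 :: 'v
  ek :: 'k
  ealpha :: 'k
  elam :: 'k

definition admissible_data ::
  "('k::field \<Rightarrow> 'v \<Rightarrow> 'v) \<Rightarrow> ('k, 'v::ab_group_add) qs_superalgebra \<Rightarrow> ('v \<Rightarrow> 'v)
     \<Rightarrow> ('k, 'v) ext_data \<Rightarrow> bool" where
  "admissible_data s H \<delta> E \<longleftrightarrow>
     superderivation s (part H) (bracket H) 0 (eD E) \<and> skew_supersymmetric_map (part H) (bform H) 0 (eD E)
     \<and> superderivation s (part H) (bracket H) 1 (eDb E) \<and> skew_supersymmetric_map (part H) (bform H) 1 (eDb E)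
     \<and> ex0 E \<in> part H 0 \<and> ec0 E \<in> part H 0 \<and> ex1 E \<in> part H 1 \<and> ec1 E \<in> part H 1 \<and> elam E \<noteq> 0
     \<and> (\<forall>x\<in>whole (part H). eDb E (eDb E x) = s (1 / 2) (bracket H (ex0 E) x))
     \<and> eDb E (ex0 E) = 0
     \<and> (\<forall>x\<in>whole (part H). supercomm s 0 1 (eD E) (eDb E) x = bracket H (ex1 E) x)
     \<and> eD E (ex0 E) = s 2 (eDb E (ex1 E))
     \<and> bform H (ex0 E) (ex1 E) = 0
     \<and> (\<forall>x\<in>whole (part H). bracket H (ec0 E) x = supercomm s 1 1 \<delta> (eDb E) x - s (elam E) (eD E x))
     \<and> (\<forall>x\<in>whole (part H). bracket H (ec1 E) x = supercomm s 1 0 \<delta> (eD E) x + s (elam E) (eDb E x))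
     \<and> \<delta> (ex0 E) = - s 2 (eDb E (ec0 E)) + s (2 * elam E) (ex1 E)
     \<and> \<delta> (ex1 E) = eD E (ec0 E) + eDb E (ec1 E) - s (elam E) (ex0 E)
     \<and> elam E * ek E = bform H (ec1 E) (ex0 E) - 2 * bform H (ex1 E) (ec0 E)"

text \<open>
  The tuple \<open>(p\<^sub>0, p\<^sub>1, X, q\<^sub>0, q\<^sub>1)\<close> stands for \<open>p\<^sub>0 e\<^sub>0\<^sup>* + p\<^sub>1 e\<^sub>1\<^sup>* + X + q\<^sub>0 e\<^sub>0 + q\<^sub>1 e\<^sub>1\<close>.
\<close>

type_synonym ('k, 'v) ext = "'k \<times> 'k \<times> 'v \<times> 'k \<times> 'k"

fun ext_scale :: "('k::field \<Rightarrow> 'v \<Rightarrow> 'v) \<Rightarrow> 'k \<Rightarrow> ('k, 'v) ext \<Rightarrow> ('k, 'v) ext" where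
  "ext_scale s c (p\<^sub>0, p\<^sub>1, X, q\<^sub>0, q\<^sub>1) = (c * p\<^sub>0, c * p\<^sub>1, s c X, c * q\<^sub>0, c * q\<^sub>1)"

definition ext_part :: "(bit \<Rightarrow> 'v set) \<Rightarrow> bit \<Rightarrow> ('k::field, 'v) ext set" where
  "ext_part V a =
     (if a = 0 then {(p, 0, X, q, 0) | p X q. X \<in> V 0} else {(0, p, X, 0, q) | p X q. X \<in> V 1})"

text \<open>The brackets \<open>[X, Y]\<close>, \<open>[e\<^sub>0, X]\<close> and \<open>[e\<^sub>1, X]\<close> of the extension, for \<open>X, Y\<close> in \<open>H\<close>.\<close>

definition ext_hh ::
  "('k::field, 'v) qs_superalgebra \<Rightarrow> ('k, 'v) ext_data \<Rightarrow> 'v \<Rightarrow> 'v \<Rightarrow> ('k, 'v) ext" where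
  "ext_hh H E X Y = (bform H (eDb E X) Y, bform H (eD E X) Y, bracket H X Y, 0, 0)"

definition ext_e0 :: "('k::field, 'v) qs_superalgebra \<Rightarrow> ('k, 'v) ext_data \<Rightarrow> 'v \<Rightarrow> ('k, 'v) ext" where
  "ext_e0 H E X = (- bform H (ex1 E) X, 0, eD E X, 0, 0)"

definition ext_e1 :: "('k::field, 'v) qs_superalgebra \<Rightarrow> ('k, 'v) ext_data \<Rightarrow> 'v \<Rightarrow> ('k, 'v) ext" where
  "ext_e1 H E X = (bform H (ex0 E) X, bform H (ex1 E) X, eDb E X, 0, 0)"

text \<open>
  Bilinear and super-skew-symmetric extension of these brackets together with \<open>[e\<^sub>0, e\<^sub>1] = x\<^sub>1\<close>,
  \<open>[e\<^sub>1, e\<^sub>1] = k e\<^sub>0\<^sup>* + x\<^sub>0\<close>, \<open>[e\<^sub>0, e\<^sub>0] = 0\<close> and \<open>e\<^sub>0\<^sup>*, e\<^sub>1\<^sup>*\<close> central; \<open>parity_inv\<close> accounts for the sign in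
  \<open>[X, e\<^sub>1] = - (-1)\<^sup>|\<^sup>X\<^sup>| [e\<^sub>1, X]\<close>.
\<close>

fun ext_bracket ::
  "('k::field \<Rightarrow> 'v \<Rightarrow> 'v) \<Rightarrow> ('k, 'v::ab_group_add) qs_superalgebra \<Rightarrow> ('k, 'v) ext_data
     \<Rightarrow> ('k, 'v) ext \<Rightarrow> ('k, 'v) ext \<Rightarrow> ('k, 'v) ext" where
  "ext_bracket s H E (p\<^sub>0, p\<^sub>1, X, q\<^sub>0, q\<^sub>1) (r\<^sub>0, r\<^sub>1, Y, t\<^sub>0, t\<^sub>1) =
     ext_hh H E X Y
     + ext_scale s q\<^sub>0 (ext_e0 H E Y) - ext_scale s t\<^sub>0 (ext_e0 H E X)
     + ext_scale s q\<^sub>1 (ext_e1 H E Y) - ext_scale s t\<^sub>1 (ext_e1 H E (parity_inv (part H) X))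
     + ext_scale s (q\<^sub>0 * t\<^sub>1 - q\<^sub>1 * t\<^sub>0) (0, 0, ex1 E, 0, 0)
     + ext_scale s (q\<^sub>1 * t\<^sub>1) (ek E, 0, ex0 E, 0, 0)"

fun ext_form :: "('k::field, 'v) qs_superalgebra \<Rightarrow> ('k, 'v) ext \<Rightarrow> ('k, 'v) ext \<Rightarrow> 'k" where
  "ext_form H (p\<^sub>0, p\<^sub>1, X, q\<^sub>0, q\<^sub>1) (r\<^sub>0, r\<^sub>1, Y, t\<^sub>0, t\<^sub>1) =
     bform H X Y + p\<^sub>0 * t\<^sub>1 + q\<^sub>1 * r\<^sub>0 + p\<^sub>1 * t\<^sub>0 + q\<^sub>0 * r\<^sub>1"

text \<open>The linear map with \<open>e\<^sub>0\<^sup>* \<mapsto> \<lambda> e\<^sub>1\<^sup>*\<close>, \<open>e\<^sub>1\<^sup>* \<mapsto> \<lambda> e\<^sub>0\<^sup>*\<close>, \<open>e\<^sub>0 \<mapsto> c\<^sub>1 - \<lambda> e\<^sub>1\<close>,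
  \<open>e\<^sub>1 \<mapsto> \<alpha> e\<^sub>0\<^sup>* + c\<^sub>0 + \<lambda> e\<^sub>0\<close> and \<open>X \<mapsto> B(c\<^sub>0, X) e\<^sub>0\<^sup>* + \<delta>(X) - B(c\<^sub>1, X) e\<^sub>1\<^sup>*\<close>.\<close>

fun ext_delta ::
  "('k::field \<Rightarrow> 'v \<Rightarrow> 'v) \<Rightarrow> ('k, 'v::ab_group_add) qs_superalgebra \<Rightarrow> ('v \<Rightarrow> 'v)
     \<Rightarrow> ('k, 'v) ext_data \<Rightarrow> ('k, 'v) ext \<Rightarrow> ('k, 'v) ext" where
  "ext_delta s H \<delta> E (p\<^sub>0, p\<^sub>1, X, q\<^sub>0, q\<^sub>1) =
     (0, elam E * p\<^sub>0, 0, 0, 0) + (elam E * p\<^sub>1, 0, 0, 0, 0)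
     + (bform H (ec0 E) X, - bform H (ec1 E) X, \<delta> X, 0, 0)
     + ext_scale s q\<^sub>0 (0, 0, ec1 E, 0, - elam E)
     + ext_scale s q\<^sub>1 (ealpha E, 0, ec0 E, elam E, 0)"

definition gen_odd_double_extension ::
  "('k::field \<Rightarrow> 'v \<Rightarrow> 'v) \<Rightarrow> ('k, 'v::ab_group_add) qs_superalgebra \<Rightarrow> ('v \<Rightarrow> 'v)
     \<Rightarrow> ('k, 'v) ext_data \<Rightarrow> ('k, ('k, 'v) ext) qs_superalgebra" where
  "gen_odd_double_extension s H \<delta> E =
     \<lparr>part = ext_part (part H), bracket = ext_bracket s H E, bform = ext_form H,
      sform = (\<lambda>u v. ext_form H (ext_delta s H \<delta> E u) v)\<rparr>"

text \<open>
  \<open>H\<close> and \<open>G\<close> live in the same ambient space, so that the relation can be iterated; since \<open>G\<close> is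
  only required to be isomorphic to the extension and \<open>H\<close> has smaller dimension than \<open>G\<close>, this is
  no restriction.
\<close>

definition double_extension_step ::
  "('k::field \<Rightarrow> 'v \<Rightarrow> 'v) \<Rightarrow> ('k, 'v::ab_group_add) qs_superalgebra
     \<Rightarrow> ('k, 'v) qs_superalgebra \<Rightarrow> bool" where
  "double_extension_step s H G \<longleftrightarrow>
     odd_quadratic_even_symplectic s H
     \<and> (\<exists>\<delta> E \<phi>. associated_superderivation s H \<delta>
            \<and> admissible_data s H \<delta> E
            \<and> qs_isomorphism (ext_scale s) (gen_odd_double_extension s H \<delta> E) s G \<phi>)"

end

theory Submission
  imports Defs
begin

text \<open>
  The two forms are linked by an odd superderivation \<open>\<delta>\<close> with \<open>\<omega>(x, y) = B(\<delta> x, y)\<close>; it is invertible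
  because \<open>\<omega>\<close> is nondegenerate, so \<open>\<delta>\<^sup>2\<close> is an invertible even derivation.  In characteristic zero
  such a derivation forces nilpotency, in the way of Jacobson's theorem, and what matters here is
  that the centre is nonzero (\<open>exists_central_root_vector\<close>).  The homogeneous generalized
  eigenvectors of \<open>\<delta>\<^sup>2\<close> span the algebra and are closed under the bracket.  The adjoint map of such
  a vector shifts eigenvalues by a fixed nonzero amount, hence is nilpotent, and an Engel argument
  yields a vector killed by all of them.

  The map \<open>\<delta>\<close> preserves the centre and swaps its even and odd parts.  So there is an even central
  \<open>f\<^sub>0 \<noteq> 0\<close> with \<open>\<delta>\<^sup>2 f\<^sub>0 = \<lambda>\<^sup>2 f\<^sub>0\<close> and \<open>\<lambda> \<noteq> 0\<close>, and with \<open>f\<^sub>1 = \<lambda>\<^sup>-\<^sup>1 \<delta> f\<^sub>0\<close> the plane \<open>I\<close> spanned by \<open>f\<^sub>0\<close> and \<open>f\<^sub>1\<close>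
  is central and stable under \<open>\<delta>\<close>.  It is isotropic for \<open>B\<close>, since
  \<open>\<lambda> B(f\<^sub>1, f\<^sub>0) = \<omega>(f\<^sub>0, f\<^sub>0) = 0\<close> and \<open>B\<close> is odd.  Choose \<open>e\<^sub>0\<close>, \<open>e\<^sub>1\<close> dual to \<open>f\<^sub>1\<close>, \<open>f\<^sub>0\<close> and orthogonal to each
  other, and let \<open>H\<close> be the orthogonal complement of these four vectors.  It is a model of
  \<open>I\<^sup>\<bottom> / I\<close> inside the given algebra: bracket and superderivation are projected, both forms are
  restricted.

  Everything bracketed lies in \<open>I\<^sup>\<bottom>\<close>, and \<open>I\<close> is central.  The projected bracket therefore satisfies
  the Jacobi identity on the whole algebra, including \<open>e\<^sub>0\<close> and \<open>e\<^sub>1\<close>.  With \<open>D = [e\<^sub>0, -]\<close>,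
  \<open>D' = [e\<^sub>1, -]\<close> (the odd one), \<open>x\<^sub>1 = [e\<^sub>0, e\<^sub>1]\<close>, \<open>x\<^sub>0 = [e\<^sub>1, e\<^sub>1]\<close>, all projected, and with \<open>c\<^sub>1\<close>, \<open>c\<^sub>0\<close>
  the projections of \<open>\<delta> e\<^sub>0\<close>, \<open>\<delta> e\<^sub>1\<close>, the conditions on the data of an extension are instances of
  the Jacobi identity, of the derivation rule for \<open>\<delta>\<close> and of the invariance of \<open>B\<close>.  So the given
  algebra is an extension of \<open>H\<close>, whose dimension is smaller, and the theorem follows by induction.
\<close>


section \<open>Finite-dimensional linear algebra inside an ambient space\<close>

context vector_space
begin

lemma card_independent_le:
  assumes "finite T" "W \<subseteq> span T" "independent A" "A \<subseteq> W"
  shows "finite A \<and> card A \<le> card T"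
  using independent_span_bound[OF assms(1,3)] assms(2,4) by blast

text \<open>
  The ambient space may be infinite dimensional, so the dimension count is carried out with a basis
  of \<open>W\<close>.
\<close>

lemma inj_endo_surj:
  assumes T: "finite T" "W \<subseteq> span T" and W: "subspace W"
    and f: "Vector_Spaces.linear scale scale f" "f ` W \<subseteq> W"
    and inj: "\<And>x. x \<in> W \<Longrightarrow> f x = 0 \<Longrightarrow> x = 0"
  shows "f ` W = W"
proof -
  interpret f: Vector_Spaces.linear scale scale f by fact
  obtain A where A: "A \<subseteq> W" "independent A" "W \<subseteq> span A"
    using maximal_independent_subset[of W] by blast
  have WA: "W = span A"
    using A W span_minimal by blast
  have finA: "finite A"
    using card_independent_le[OF T A(2,1)] by blast
  have injW: "inj_on f W"
  proof (rule inj_onI)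
    fix x y assume "x \<in> W" "y \<in> W" "f x = f y"
    then have "x - y = 0"
      using inj[of "x - y"] subspace_diff[OF W] by (simp add: f.diff)
    then show "x = y" by simp
  qed
  have ind: "independent (f ` A)"
    using f.independent_injective_image[OF A(2)] injW WA by blast
  have card: "card (f ` A) = card A"
    using injW A(1) by (meson card_image inj_on_subset)
  \<comment> \<open>An independent set with as many elements as the spanning set \<open>A\<close> spans as well.\<close>
  have "A \<subseteq> span (f ` A)"
  proof (rule ccontr)
    assume "\<not> A \<subseteq> span (f ` A)"
    then obtain a where a: "a \<in> A" "a \<notin> span (f ` A)" by blast
    then have "independent (insert a (f ` A))" using ind by (simp add: independent_insertI)
    moreover have "insert a (f ` A) \<subseteq> span A"
      using a A f(2) WA by blast
    ultimately have "card (insert a (f ` A)) \<le> card A"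
      using card_independent_le[OF finA] by blast
    moreover have "a \<notin> f ` A" using a span_base by blast
    ultimately show False using card finA by simp
  qed
  then have "W \<subseteq> f ` W" using WA f.span_image span_minimal subspace_span by metis
  then show ?thesis using f(2) by blast
qed

lemma subspace_projection:
  assumes W: "subspace W"
  obtains P where "Vector_Spaces.linear scale scale P" "\<And>x. P x \<in> W" "\<And>x. x \<in> W \<Longrightarrow> P x = x"
proof -
  interpret vector_space_pair scale scale ..
  obtain P where "range P \<subseteq> W" "Vector_Spaces.linear scale scale P" "\<forall>v\<in>W. P v = v"
    using linear_exists_left_inverse_on[OF linear_id W] by auto
  then show ?thesis using that by blast
qed

end

lemma eq_minus_self_zero:
  fixes x :: "'k::field_char_0"
  assumes "x = - x"
  shows "x = 0"
proof -
  have "2 * x = 0" using assms by (metis add.right_inverse mult_2)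
  then show ?thesis by simp
qed

lemma msgn_simps [simp]: "msgn 0 = 1" "msgn 1 = -1"
  by (simp_all add: msgn_def)

locale linear_endo = vector_space scale
  for scale :: "'k::field \<Rightarrow> 'v::ab_group_add \<Rightarrow> 'v" +
  fixes S :: "'v \<Rightarrow> 'v"
  assumes S_add: "S (x + y) = S x + S y"
    and S_scale: "S (scale c x) = scale c (S x)"
begin

lemma S_0 [simp]: "S 0 = 0"
  using S_scale[of 0 0] by simp

lemma S_minus: "S (- x) = - S x"
  using S_scale[of "-1" x] by simp

lemma S_diff: "S (x - y) = S x - S y"
  using S_add[of x "- y"] by (simp add: S_minus)

text \<open>
  \<open>poly_act p v\<close> is \<open>p(S) v\<close>, in the form of Horner's scheme.
\<close>

definition poly_act :: "'k poly \<Rightarrow> 'v \<Rightarrow> 'v" where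
  "poly_act p v = fold_coeffs (\<lambda>a w. scale a v + S w) p 0"

lemma poly_act_0 [simp]: "poly_act 0 v = 0"
  by (simp add: poly_act_def)

lemma poly_act_pCons [simp]: "poly_act (pCons a p) v = scale a v + S (poly_act p v)"
  by (cases "a = 0 \<and> p = 0") (auto simp: poly_act_def)

lemma poly_act_add: "poly_act (p + q) v = poly_act p v + poly_act q v"
  by (induction p q rule: poly_induct2) (auto simp: S_add scale_left_distrib algebra_simps)

lemma poly_act_smult: "poly_act (smult c p) v = scale c (poly_act p v)"
  by (induction p) (auto simp: S_scale scale_right_distrib)

lemma poly_act_mult: "poly_act (p * q) v = poly_act p (poly_act q v)"
  by (induction p) (auto simp: poly_act_add poly_act_smult)

lemma poly_act_linear_factor:
  "poly_act ([:- c, 1:] * q) v = S (poly_act q v) - scale c (poly_act q v)"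
  unfolding poly_act_mult by simp

lemma poly_act_vadd: "poly_act p (v + w) = poly_act p v + poly_act p w"
  by (induction p) (auto simp: S_add scale_right_distrib)

lemma poly_act_vscale: "poly_act p (scale c v) = scale c (poly_act p v)"
  by (induction p) (auto simp: S_scale scale_right_distrib)

lemma poly_act_v0 [simp]: "poly_act p 0 = 0"
  by (induction p) auto

lemma poly_act_eigenvector: "S v = scale c v \<Longrightarrow> poly_act p v = scale (poly p c) v"
  by (induction p) (auto simp: S_scale scale_left_distrib algebra_simps)

lemma poly_act_closed:
  "subspace U \<Longrightarrow> S ` U \<subseteq> U \<Longrightarrow> v \<in> U \<Longrightarrow> poly_act p v \<in> U"
  by (induction p) (auto simp: subspace_0 intro!: subspace_add subspace_scale)

lemma poly_act_monom: "poly_act (monom 1 n) v = (S ^^ n) v"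
  by (induction n) (auto simp: monom_Suc monom_0)

text \<open>
  The orbit \<open>v, S v, S\<^sup>2 v, \<dots>\<close> stays in a finite-dimensional space, so some \<open>S\<^sup>n v\<close> is a combination
  of the earlier ones.
\<close>

lemma exists_annihilating_poly:
  assumes "finite T" "W \<subseteq> span T" "subspace W" "S ` W \<subseteq> W" "v \<in> W"
  shows "\<exists>p. p \<noteq> 0 \<and> poly_act p v = 0"
proof -
  define orb where "orb n = (\<lambda>i. (S ^^ i) v) ` {..<n}" for n :: nat
  have orbW: "(S ^^ i) v \<in> W" for i
    using assms(4,5) by (induction i) auto
  have "\<exists>n. (S ^^ n) v \<in> span (orb n)"
  proof (rule ccontr)
    assume none: "\<not> ?thesis"
    have "independent (orb n) \<and> card (orb n) = n" for n
    proof (induction n)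
      case (Suc n)
      have "orb (Suc n) = insert ((S ^^ n) v) (orb n)"
        by (auto simp: orb_def lessThan_Suc)
      moreover have "(S ^^ n) v \<notin> orb n" using none span_base by blast
      moreover have "finite (orb n)" by (simp add: orb_def)
      ultimately show ?case using Suc none by (simp add: independent_insertI)
    qed (simp add: orb_def independent_empty)
    moreover have "orb n \<subseteq> W" for n using orbW by (auto simp: orb_def)
    ultimately show False
      using card_independent_le[OF assms(1,2), of "orb (Suc (card T))"] by auto
  qed
  then obtain n where n: "(S ^^ n) v \<in> span (orb n)" by blast
  define L where "L = {poly_act q v | q. \<forall>i\<ge>n. coeff q i = 0}"
  have "subspace L"
  proof (rule subspaceI)
    show "0 \<in> L" unfolding L_def by (auto intro!: exI[of _ 0])
  next
    fix x y assume "x \<in> L" "y \<in> L"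
    then obtain p q where "x = poly_act p v" "\<forall>i\<ge>n. coeff p i = 0" "y = poly_act q v" "\<forall>i\<ge>n. coeff q i = 0"
      unfolding L_def by blast
    then show "x + y \<in> L" unfolding L_def by (auto simp: poly_act_add intro!: exI[of _ "p + q"])
  next
    fix c x assume "x \<in> L"
    then obtain p where "x = poly_act p v" "\<forall>i\<ge>n. coeff p i = 0"
      unfolding L_def by blast
    then show "scale c x \<in> L" unfolding L_def
      by (auto simp: poly_act_smult intro!: exI[of _ "smult c p"])
  qed
  moreover have "orb n \<subseteq> L"
    unfolding orb_def L_def by (auto simp: poly_act_monom[symmetric] intro!: exI[of _ "monom 1 _"])
  ultimately have "(S ^^ n) v \<in> L" using n span_minimal by blast
  then obtain q where q: "(S ^^ n) v = poly_act q v" "\<forall>i\<ge>n. coeff q i = 0"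
    unfolding L_def by blast
  let ?p = "monom 1 n + smult (-1) q"
  have "coeff ?p n = 1" using q(2) by simp
  then have "?p \<noteq> 0" by auto
  moreover have "poly_act ?p v = 0"
    using q(1) by (simp add: poly_act_add poly_act_smult poly_act_monom del: smult_minus_left)
  ultimately show ?thesis by blast
qed

text \<open>
  Polynomials in \<open>S\<close> commute, so the product of annihilating polynomials of the elements of a basis
  annihilates all of \<open>W\<close>.
\<close>

lemma exists_annihilating_poly_subspace:
  assumes T: "finite T" "W \<subseteq> span T" and W: "subspace W" "S ` W \<subseteq> W"
  shows "\<exists>p. p \<noteq> 0 \<and> (\<forall>v\<in>W. poly_act p v = 0)"
proof -
  obtain A where A: "A \<subseteq> W" "independent A" "W \<subseteq> span A"
    using maximal_independent_subset[of W] by blast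
  have finA: "finite A" using card_independent_le[OF T A(2,1)] by blast
  have "\<exists>p. p \<noteq> 0 \<and> (\<forall>v\<in>A. poly_act p v = 0)"
    using finA A(1)
  proof induction
    case empty show ?case by (auto intro: exI[of _ 1])
  next
    case (insert a A)
    then obtain p where p: "p \<noteq> 0" "\<forall>v\<in>A. poly_act p v = 0" by auto
    obtain q where q: "q \<noteq> 0" "poly_act q a = 0"
      using exists_annihilating_poly[OF assms] insert.prems by blast
    have "p * q \<noteq> 0" using p q by simp
    moreover have "poly_act (p * q) a = 0" using q(2) by (simp add: poly_act_mult)
    moreover have "poly_act (p * q) v = 0" if "v \<in> A" for v
      using p(2) that by (simp add: mult.commute[of p] poly_act_mult)
    ultimately show ?case by blast
  qed
  then obtain p where p: "p \<noteq> 0" "\<forall>v\<in>A. poly_act p v = 0" by blast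
  have "poly_act p v = 0" if "v \<in> span A" for v
    using that by (induction rule: span_induct_alt) (use p in \<open>auto simp: poly_act_vadd poly_act_vscale\<close>)
  then show ?thesis using p A(3) by blast
qed

end

text \<open>
  This is the existence of an eigenvector of \<open>S\<close> on \<open>W / U\<close>, phrased without the quotient: if \<open>p\<close> has
  least degree with \<open>p(S) v \<in> U\<close>, then splitting off a linear factor leaves a polynomial \<open>q\<close> with
  \<open>q(S) v \<notin> U\<close>.  For \<open>U = {0}\<close> it gives eigenvectors; with a larger \<open>U\<close> it serves below to show that
  generalized eigenvectors span.
\<close>

lemma relative_eigenvector:
  fixes scale :: "'k::alg_closed_field \<Rightarrow> 'v::ab_group_add \<Rightarrow> 'v"
  assumes "linear_endo scale S"
    and T: "finite T" "W \<subseteq> module.span scale T" and W: "module.subspace scale W" "S ` W \<subseteq> W"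
    and v: "v \<in> W" "v \<notin> U" and U: "module.subspace scale U"
  shows "\<exists>w c. w \<in> W \<and> w \<notin> U \<and> S w - scale c w \<in> U"
proof -
  interpret linear_endo scale S by fact
  define Q where "Q n \<longleftrightarrow> (\<exists>p. p \<noteq> 0 \<and> poly_act p v \<in> U \<and> degree p = n)" for n
  obtain n where n: "Q n" "\<And>m. m < n \<Longrightarrow> \<not> Q m"
  proof -
    have "\<exists>n. Q n" unfolding Q_def using exists_annihilating_poly[OF T W v(1)] subspace_0[OF U] by metis
    then show ?thesis using that exists_least_iff[of Q] by blast
  qed
  then obtain p where p: "p \<noteq> 0" "poly_act p v \<in> U" "degree p = n" unfolding Q_def by blast
  \<comment> \<open>A constant \<open>p\<close> would put \<open>v\<close> itself into \<open>U\<close>.\<close>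
  have "\<exists>c. poly p c = 0"
  proof (cases "degree p = 0")
    case True
    then obtain a where a: "p = [:a:]" using degree_eq_zeroE by blast
    have "a \<noteq> 0" using p a by simp
    have "scale a v \<in> U" using p a by simp
    then have "v \<in> U" using subspace_scale[OF U, of "scale a v" "1 / a"] \<open>a \<noteq> 0\<close> by simp
    then show ?thesis using v(2) by simp
  next
    case False then show ?thesis using alg_closed_imp_poly_has_root by blast
  qed
  then obtain c where "[:- c, 1:] dvd p" using poly_eq_0_iff_dvd by blast
  then obtain q where q: "p = [:- c, 1:] * q" by blast
  have q0: "q \<noteq> 0" using p q by auto
  then have "degree p = Suc (degree q)" unfolding q by (subst degree_mult_eq) auto
  then have "poly_act q v \<notin> U" using n(2)[of "degree q"] p q0 unfolding Q_def by auto
  moreover have "S (poly_act q v) - scale c (poly_act q v) \<in> U"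
    using p(2) unfolding q poly_act_linear_factor .
  ultimately show ?thesis using poly_act_closed[OF W v(1)] by blast
qed


section \<open>Homogeneous parts\<close>

context super_space
begin

lemma zero_in [simp]: "0 \<in> V a"
  by (rule subspace_0[OF subspace_part])

lemma part_add: "x \<in> V a \<Longrightarrow> y \<in> V a \<Longrightarrow> x + y \<in> V a"
  by (rule subspace_add[OF subspace_part])

lemma part_diff: "x \<in> V a \<Longrightarrow> y \<in> V a \<Longrightarrow> x - y \<in> V a"
  by (rule subspace_diff[OF subspace_part])

lemma part_scale: "x \<in> V a \<Longrightarrow> scale c x \<in> V a"
  by (rule subspace_scale[OF subspace_part])

lemma whole_add_parts: "x \<in> V 0 \<Longrightarrow> y \<in> V 1 \<Longrightarrow> x + y \<in> whole V"
  unfolding whole_def by blast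

lemma part_whole: "x \<in> V a \<Longrightarrow> x \<in> whole V"
  using whole_add_parts[of x 0] whole_add_parts[of 0 x] by (cases a) auto

lemma wholeE:
  assumes "x \<in> whole V"
  obtains x0 x1 where "x = x0 + x1" "x0 \<in> V 0" "x1 \<in> V 1"
  using assms unfolding whole_def by blast

lemma subspace_whole: "subspace (whole V)"
proof (rule subspaceI)
  show "0 \<in> whole V" by (rule part_whole[of _ 0]) simp
next
  fix x y assume "x \<in> whole V" "y \<in> whole V"
  then obtain x0 x1 y0 y1 where "x = x0 + x1" "x0 \<in> V 0" "x1 \<in> V 1"
    "y = y0 + y1" "y0 \<in> V 0" "y1 \<in> V 1" by (elim wholeE) blast
  then have "x + y = (x0 + y0) + (x1 + y1)" "x0 + y0 \<in> V 0" "x1 + y1 \<in> V 1"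
    by (auto intro: part_add)
  then show "x + y \<in> whole V" using whole_add_parts by metis
next
  fix c x assume "x \<in> whole V"
  then obtain x0 x1 where "x = x0 + x1" "x0 \<in> V 0" "x1 \<in> V 1" by (elim wholeE) blast
  then show "scale c x \<in> whole V"
    by (auto simp: scale_right_distrib intro: whole_add_parts part_scale)
qed

lemmas whole_add = subspace_add[OF subspace_whole]
lemmas whole_diff = subspace_diff[OF subspace_whole]
lemmas whole_scale = subspace_scale[OF subspace_whole]
lemmas whole_0 [simp] = subspace_0[OF subspace_whole]

lemma parts_unique:
  assumes "x0 + x1 = y0 + y1" "x0 \<in> V 0" "x1 \<in> V 1" "y0 \<in> V 0" "y1 \<in> V 1"
  shows "x0 = y0 \<and> x1 = y1"
proof -
  have "x0 - y0 = y1 - x1" using assms(1) by (simp add: algebra_simps)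
  then have "x0 - y0 \<in> V 0 \<inter> V 1" using assms part_diff by (metis IntI)
  then have "x0 - y0 = 0" using independent_parts by simp
  then show ?thesis using assms(1) by simp
qed

end


section \<open>Lie superalgebras with a globally bilinear bracket\<close>

text \<open>
  The bracket factors through a linear projection \<open>P\<close> of the ambient space onto the superalgebra.
  This makes it bilinear on the whole ambient type, so that brackets can be expanded without proving
  memberships.
\<close>

locale total_lie_superalgebra = lie_superalgebra scale V br
  for scale :: "'k::{alg_closed_field, field_char_0} \<Rightarrow> 'v::ab_group_add \<Rightarrow> 'v"
    and V :: "bit \<Rightarrow> 'v set" and br :: "'v \<Rightarrow> 'v \<Rightarrow> 'v" +
  fixes P :: "'v \<Rightarrow> 'v"
  assumes P_linear: "Vector_Spaces.linear scale scale P"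
    and P_in: "P x \<in> whole V"
    and P_id: "x \<in> whole V \<Longrightarrow> P x = x"
    and br_P: "br x y = br (P x) (P y)"
begin

lemma P_add: "P (x + y) = P x + P y" and P_scale: "P (scale c x) = scale c (P x)"
proof -
  interpret P: Vector_Spaces.linear scale scale P by (rule P_linear)
  show "P (x + y) = P x + P y" "P (scale c x) = scale c (P x)"
    by (simp_all add: P.add P.scale)
qed

lemma br_add_left: "br (x + y) z = br x z + br y z"
  and br_add_right: "br z (x + y) = br z x + br z y"
  and br_scale_left: "br (scale c x) z = scale c (br x z)"
  and br_scale_right: "br z (scale c x) = scale c (br z x)"
proof -
  note * = br_bilinear[unfolded bilinear_on_def linear_on_def]
  show "br (x + y) z = br x z + br y z"
    using * P_in br_P[of "x + y"] br_P[of x z] br_P[of y z] by (simp add: P_add)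
  show "br z (x + y) = br z x + br z y"
    using * P_in br_P[of _ "x + y"] br_P[of z x] br_P[of z y] by (simp add: P_add)
  show "br (scale c x) z = scale c (br x z)"
    using * P_in br_P[of "scale c x"] br_P[of x z] by (simp add: P_scale)
  show "br z (scale c x) = scale c (br z x)"
    using * P_in br_P[of _ "scale c x"] br_P[of z x] by (simp add: P_scale)
qed

lemma br_0_left [simp]: "br 0 x = 0" and br_0_right [simp]: "br x 0 = 0"
  using br_scale_left[of 0 0 x] br_scale_right[of x 0 0] by auto

lemma br_minus_left: "br (- x) y = - br x y" and br_minus_right: "br x (- y) = - br x y"
  using br_scale_left[of "-1" x y] br_scale_right[of x "-1" y] by auto

lemma br_diff_left: "br (x - y) z = br x z - br y z"
  and br_diff_right: "br z (x - y) = br z x - br z y"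
  using br_add_left[of x "- y" z] br_add_right[of z x "- y"]
  by (auto simp: br_minus_left br_minus_right)

lemmas br_linear = br_add_left br_add_right br_scale_left br_scale_right br_minus_left
  br_minus_right br_diff_left br_diff_right

lemma br_whole: "br x y \<in> whole V"
proof -
  obtain x0 x1 y0 y1 where "P x = x0 + x1" "x0 \<in> V 0" "x1 \<in> V 1"
    "P y = y0 + y1" "y0 \<in> V 0" "y1 \<in> V 1"
    using P_in wholeE by metis
  then show ?thesis unfolding br_P[of x y]
    by (auto simp: br_linear intro!: whole_add intro: part_whole br_graded)
qed

text \<open>
  The Jacobi identity says that \<open>br x\<close> is a superderivation; in this form only two of the three
  vectors have to be homogeneous.
\<close>

lemma br_leibniz_homogeneous:
  assumes "x \<in> V a" "y \<in> V b" "z \<in> V c"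
  shows "br x (br y z) = br (br x y) z + scale (msgn (a * b)) (br y (br x z))"
proof -
  have 1: "br z x = - scale (msgn (c * a)) (br x z)"
    using assms by (intro br_skew)
  have 2: "br z (br x y) = - scale (msgn (c * (a + b))) (br (br x y) z)"
    using assms by (intro br_skew br_graded)
  have "scale (msgn (a * c))
      (br x (br y z) - br (br x y) z - scale (msgn (a * b)) (br y (br x z))) = 0"
    using br_jacobi[OF assms] unfolding 1 2
    by (cases a; cases b; cases c; simp add: br_minus_right br_scale_right) (simp_all add: algebra_simps)
  then show ?thesis by (simp add: msgn_def algebra_simps split: if_splits)
qed

lemma br_leibniz:
  assumes "x \<in> V a" "y \<in> V b"
  shows "br x (br y z) = br (br x y) z + scale (msgn (a * b)) (br y (br x z))"
proof -
  obtain z0 z1 where z: "P z = z0 + z1" "z0 \<in> V 0" "z1 \<in> V 1" using P_in wholeE by metis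
  have "br x (br y (P z)) = br (br x y) (P z) + scale (msgn (a * b)) (br y (br x (P z)))"
    unfolding z(1) br_add_right
    unfolding br_leibniz_homogeneous[OF assms z(2)] br_leibniz_homogeneous[OF assms z(3)]
    by (simp add: scale_right_distrib algebra_simps)
  moreover have "br u (P z) = br u z" for u
    using br_P[of u z] br_P[of u "P z"] P_id[OF P_in] by simp
  ultimately show ?thesis by simp
qed

end


section \<open>An invertible even derivation forces a central element\<close>

locale lie_superalgebra_derivation =
  total_lie_superalgebra scale V br P + linear_endo scale S
  for scale :: "'k::{alg_closed_field, field_char_0} \<Rightarrow> 'v::ab_group_add \<Rightarrow> 'v"
    and V br P S +
  assumes S_graded: "x \<in> V a \<Longrightarrow> S x \<in> V a"
    and S_derivation: "S (br x y) = br (S x) y + br x (S y)"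
    and S_inj: "x \<in> V a \<Longrightarrow> S x = 0 \<Longrightarrow> x = 0"
begin

text \<open>
  The vectors killed by some power of \<open>S - c\<close>; the inductive form turns an induction on the exponent
  into rule induction.
\<close>

inductive_set gen_eigenspace :: "'k \<Rightarrow> 'v set" for c where
  zero: "0 \<in> gen_eigenspace c"
| step: "S x - scale c x \<in> gen_eigenspace c \<Longrightarrow> x \<in> gen_eigenspace c"

lemma gen_eigenspace_down: "x \<in> gen_eigenspace c \<Longrightarrow> S x - scale c x \<in> gen_eigenspace c"
  by (cases rule: gen_eigenspace.cases) (simp_all add: gen_eigenspace.zero)

lemma gen_eigenspace_add:
  "x \<in> gen_eigenspace c \<Longrightarrow> y \<in> gen_eigenspace c \<Longrightarrow> x + y \<in> gen_eigenspace c"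
proof (induction arbitrary: y rule: gen_eigenspace.induct)
  case (step x)
  have "S x - scale c x + (S y - scale c y) \<in> gen_eigenspace c"
    using step.IH gen_eigenspace_down[OF step.prems] by blast
  then show ?case
    by - (rule gen_eigenspace.step, simp add: S_add scale_right_distrib algebra_simps)
qed simp

lemma gen_eigenspace_scale: "x \<in> gen_eigenspace c \<Longrightarrow> scale k x \<in> gen_eigenspace c"
proof (induction rule: gen_eigenspace.induct)
  case (step x)
  then show ?case
    by - (rule gen_eigenspace.step, simp add: S_scale scale_right_diff_distrib mult.commute)
qed (simp add: gen_eigenspace.zero)

text \<open>
  The rule \<open>(S - c - d) [x, y] = [(S - c) x, y] + [x, (S - d) y]\<close> lowers one of the two exponents.
\<close>

lemma br_gen_eigenspace:
  assumes "x \<in> gen_eigenspace c" "y \<in> gen_eigenspace d"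
  shows "br x y \<in> gen_eigenspace (c + d)"
  using assms
proof (induction arbitrary: y rule: gen_eigenspace.induct)
  case zero then show ?case by (simp add: gen_eigenspace.zero)
next
  case (step x)
  note outer = step.IH
  from step.prems show ?case
  proof (induction rule: gen_eigenspace.induct)
    case zero then show ?case by (simp add: gen_eigenspace.zero)
  next
    case (step y)
    have "br (S x - scale c x) y + br x (S y - scale d y) \<in> gen_eigenspace (c + d)"
      using outer[of y] step gen_eigenspace.step by (intro gen_eigenspace_add) blast+
    then show ?case
      by - (rule gen_eigenspace.step, simp add: S_derivation br_linear scale_left_distrib algebra_simps)
  qed
qed

lemma gen_eigenspace_eigenvector:
  "x \<in> gen_eigenspace c \<Longrightarrow> x \<in> V a \<Longrightarrow> x \<noteq> 0 \<Longrightarrow> \<exists>v\<in>V a. v \<noteq> 0 \<and> S v = scale c v"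
proof (induction rule: gen_eigenspace.induct)
  case (step x)
  show ?case
  proof (cases "S x - scale c x = 0")
    case True then show ?thesis using step.prems by auto
  next
    case False then show ?thesis using step S_graded part_diff part_scale by blast
  qed
qed simp

lemma S_whole: "S ` whole V \<subseteq> whole V"
  by (auto elim!: wholeE simp: S_add intro!: whole_add_parts S_graded)

lemma finite_eigenvalues:
  "finite {c. \<exists>a x. x \<in> V a \<and> x \<in> gen_eigenspace c \<and> x \<noteq> 0}"
proof -
  obtain T where "finite T" "whole V \<subseteq> span T" using finite_dim by blast
  then obtain p where p: "p \<noteq> 0" "\<forall>v\<in>whole V. poly_act p v = 0"
    using exists_annihilating_poly_subspace subspace_whole S_whole by metis
  have "poly p c = 0" if x: "x \<in> V a" "x \<in> gen_eigenspace c" "x \<noteq> 0" for a x c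
  proof -
    obtain v where "v \<in> V a" "v \<noteq> 0" "S v = scale c v"
      using gen_eigenspace_eigenvector x by blast
    then show ?thesis using p(2) poly_act_eigenvector[of v c p] part_whole by auto
  qed
  then have "{c. \<exists>a x. x \<in> V a \<and> x \<in> gen_eigenspace c \<and> x \<noteq> 0} \<subseteq> {c. poly p c = 0}" by blast
  then show ?thesis using poly_roots_finite[OF p(1)] finite_subset by blast
qed

text \<open>
  The set of homogeneous generalized eigenvectors is closed under the bracket and spans, but it need
  not be a subspace; Engel's argument below works with such a set, since only its elements are known to
  have nilpotent adjoint maps.
\<close>

definition root_vectors :: "'v set" where
  "root_vectors = (\<Union>a c. V a \<inter> gen_eigenspace c)"

lemma root_vectorsI: "x \<in> V a \<Longrightarrow> x \<in> gen_eigenspace c \<Longrightarrow> x \<in> root_vectors"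
  unfolding root_vectors_def by blast

lemma root_vectorsE:
  assumes "x \<in> root_vectors"
  obtains a c where "x \<in> V a" "x \<in> gen_eigenspace c"
  using assms unfolding root_vectors_def by blast

lemma root_vectors_br: "x \<in> root_vectors \<Longrightarrow> y \<in> root_vectors \<Longrightarrow> br x y \<in> root_vectors"
  by (elim root_vectorsE) (rule root_vectorsI[OF br_graded br_gen_eigenspace])

lemma root_vectors_whole: "root_vectors \<subseteq> whole V"
  unfolding root_vectors_def using part_whole by blast

text \<open>
  If \<open>x\<close> has eigenvalue \<open>c\<close> and \<open>y\<close> has eigenvalue \<open>d\<close>, then \<open>(br x)\<^sup>n y\<close> has eigenvalue \<open>d + n c\<close>.
  These are pairwise different, because \<open>c \<noteq> 0\<close> by injectivity of \<open>S\<close> and the characteristic is zero,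
  but there are only finitely many eigenvalues.
\<close>

lemma ad_nilpotent_on_root_vectors:
  assumes x: "x \<in> root_vectors" and y: "y \<in> root_vectors"
  shows "\<exists>n. (br x ^^ n) y = 0"
proof (rule ccontr)
  assume nz: "\<not> ?thesis"
  obtain a c where xa: "x \<in> V a" "x \<in> gen_eigenspace c" using x by (rule root_vectorsE)
  obtain b d where yb: "y \<in> V b" "y \<in> gen_eigenspace d" using y by (rule root_vectorsE)
  have "x \<noteq> 0"
  proof
    assume "x = 0"
    then have "(br x ^^ 1) y = 0" by simp
    then show False using nz by blast
  qed
  then obtain v where "v \<in> V a" "v \<noteq> 0" "S v = scale c v"
    using gen_eigenspace_eigenvector xa by blast
  then have c: "c \<noteq> 0" using S_inj by auto
  have *: "(\<exists>e. (br x ^^ n) y \<in> V e) \<and> (br x ^^ n) y \<in> gen_eigenspace (d + of_nat n * c)" for n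
  proof (induction n)
    case 0 then show ?case using yb by auto
  next
    case (Suc n)
    have eq: "d + of_nat (Suc n) * c = c + (d + of_nat n * c)" by (simp add: algebra_simps)
    from Suc have "br x ((br x ^^ n) y) \<in> gen_eigenspace (c + (d + of_nat n * c))"
      using br_gen_eigenspace[OF xa(2)] by blast
    moreover from Suc have "\<exists>e. br x ((br x ^^ n) y) \<in> V e" using br_graded[OF xa(1)] by blast
    ultimately show ?case unfolding eq by simp
  qed
  have "range (\<lambda>n. d + of_nat n * c) \<subseteq> {c. \<exists>a x. x \<in> V a \<and> x \<in> gen_eigenspace c \<and> x \<noteq> 0}"
    using * nz by blast
  then have "finite (range (\<lambda>n::nat. d + of_nat n * c))"
    using finite_eigenvalues finite_subset by blast
  moreover have "inj (\<lambda>n::nat. d + of_nat n * c)" using c by (auto intro!: injI)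
  ultimately show False using finite_imageD infinite_UNIV_nat by blast
qed

text \<open>
  Otherwise some \<open>w\<close> outside the span \<open>R\<close> is an eigenvector modulo \<open>R\<close>, with eigenvalue \<open>c\<close> say.  As
  \<open>S - c\<close> is onto on the generalized eigenspaces for all other eigenvalues, \<open>w\<close> can be changed by an
  element of \<open>R\<close> into a generalized eigenvector for \<open>c\<close>, which lies in \<open>R\<close>.
\<close>

lemma part_subset_span_root_vectors: "V a \<subseteq> span root_vectors"
proof -
  define R where "R = {x \<in> V a. \<exists>c. x \<in> gen_eigenspace c}"
  have RV: "span R \<subseteq> V a"
    using subspace_part by (intro span_minimal) (auto simp: R_def)
  have shift: "\<exists>m\<in>span R. S m - scale c m = x"
    if "x \<in> gen_eigenspace d" "x \<in> V a" "c \<noteq> d" for x c d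
    using that
  proof (induction rule: gen_eigenspace.induct)
    case zero then show ?case by (intro bexI[of _ 0]) (auto simp: span_zero)
  next
    case (step x)
    then obtain m where m: "m \<in> span R" "S m - scale c m = S x - scale d x"
      using S_graded part_diff part_scale by blast
    \<comment> \<open>If \<open>(S - c) m = (S - d) x\<close>, then \<open>(S - c) (x - m) = (d - c) x\<close>.\<close>
    have "x \<in> gen_eigenspace d" using step.hyps by (rule gen_eigenspace.step)
    then have "x \<in> R" using step.prems unfolding R_def by blast
    then have "scale (1 / (d - c)) (x - m) \<in> span R"
      using m(1) by (intro span_scale span_diff) (auto intro: span_base)
    moreover have "S (scale (1 / (d - c)) (x - m)) - scale c (scale (1 / (d - c)) (x - m))
        = scale (1 / (d - c)) (scale (d - c) x)"
    proof -
      have "S (scale (1 / (d - c)) (x - m)) - scale c (scale (1 / (d - c)) (x - m))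
          = scale (1 / (d - c)) ((S x - scale c x) - (S m - scale c m))"
        by (simp add: S_scale S_diff scale_right_diff_distrib algebra_simps)
      then show ?thesis unfolding m(2) by (simp add: scale_left_diff_distrib)
    qed
    ultimately show ?case using step.prems(2) by (intro bexI) auto
  qed
  have split: "\<exists>m\<in>span R. \<exists>g\<in>V a \<inter> gen_eigenspace c. u = S m - scale c m + g"
    if "u \<in> span R" for u c
    using that
  proof (induction rule: span_induct_alt)
    case base
    show ?case by (intro bexI[of _ 0]) (auto simp: span_zero gen_eigenspace.zero)
  next
    case (step k x y)
    obtain m g where mg: "m \<in> span R" "g \<in> V a" "g \<in> gen_eigenspace c" "y = S m - scale c m + g"
      using step.IH by blast
    obtain d where xd: "x \<in> V a" "x \<in> gen_eigenspace d" using step.hyps unfolding R_def by blast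
    show ?case
    proof (cases "c = d")
      case True
      then show ?thesis using mg xd
        by (intro bexI[of _ m] bexI[of _ "scale k x + g"])
          (auto intro: part_add part_scale gen_eigenspace_add gen_eigenspace_scale)
    next
      case False
      then obtain m' where "m' \<in> span R" "S m' - scale c m' = x" using shift xd by blast
      then show ?thesis using mg
        by (intro bexI[of _ "scale k m' + m"] bexI[of _ g])
          (auto simp: S_add S_scale scale_right_distrib scale_right_diff_distrib algebra_simps
            intro: span_add span_scale)
    qed
  qed
  have "V a \<subseteq> span R"
  proof (rule ccontr)
    assume "\<not> V a \<subseteq> span R"
    then obtain v where v: "v \<in> V a" "v \<notin> span R" by blast
    obtain T where T: "finite T" "V a \<subseteq> span T" using finite_dim part_whole by blast
    have "linear_endo scale S" by unfold_locales
    then obtain w c where w: "w \<in> V a" "w \<notin> span R" "S w - scale c w \<in> span R"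
      using relative_eigenvector[OF _ T subspace_part _ v subspace_span, of S] S_graded
      by (metis image_subsetI)
    then obtain m g where mg: "m \<in> span R" "g \<in> gen_eigenspace c" "S w - scale c w = S m - scale c m + g"
      using split by blast
    have "S (w - m) - scale c (w - m) = g"
      using mg(3) by (simp add: S_diff scale_right_diff_distrib algebra_simps)
    then have "w - m \<in> gen_eigenspace c" using mg(2) gen_eigenspace.step by metis
    moreover have "w - m \<in> V a" using w(1) mg(1) RV part_diff by blast
    ultimately have "w - m \<in> span R" by (intro span_base) (auto simp: R_def)
    from span_add[OF this mg(1)] show False using w(2) by simp
  qed
  also have "span R \<subseteq> span root_vectors"
    by (rule span_mono) (auto simp: R_def root_vectors_def)
  finally show ?thesis .
qed

lemma whole_eq_span_root_vectors: "whole V = span root_vectors"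
proof
  show "span root_vectors \<subseteq> whole V"
    by (rule span_minimal[OF root_vectors_whole subspace_whole])
  show "whole V \<subseteq> span root_vectors"
    using part_subset_span_root_vectors by (auto elim!: wholeE intro: span_add)
qed

lemma ad_nilpotent:
  assumes x: "x \<in> root_vectors" and y: "y \<in> whole V"
  shows "\<exists>n. (br x ^^ n) y = 0"
proof -
  have zero: "(br x ^^ n) 0 = 0" for n by (induction n) auto
  have mono: "(br x ^^ (m + n)) u = 0" if "(br x ^^ n) u = 0" for m n u
    using that zero by (simp add: funpow_add)
  have lin: "(br x ^^ n) (scale k u + w) = scale k ((br x ^^ n) u) + (br x ^^ n) w" for n k u w
    by (induction n) (auto simp: br_linear)
  have "y \<in> span root_vectors" using y whole_eq_span_root_vectors by simp
  then show ?thesis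
  proof (induction rule: span_induct_alt)
    case base show ?case using zero by blast
  next
    case (step k u w)
    obtain m n where "(br x ^^ m) u = 0" "(br x ^^ n) w = 0"
      using step.IH ad_nilpotent_on_root_vectors[OF x step.hyps] by blast
    then have "(br x ^^ (m + n)) u = 0" "(br x ^^ (m + n)) w = 0"
      using mono[of m u n] mono[of n w m] by (simp_all add: add.commute)
    then show ?case using lin[of "m + n" k u w] by auto
  qed
qed

definition ad_closed :: "'v set \<Rightarrow> 'v set \<Rightarrow> bool" where
  "ad_closed A U \<longleftrightarrow> (\<forall>x\<in>A. \<forall>u\<in>U. br x u \<in> U)"

text \<open>
  The conclusion of Engel's theorem for \<open>A\<close> acting on \<open>Y\<close> modulo \<open>U\<close>.  The set \<open>Y\<close> is arbitrary:
  taking \<open>Y = root_vectors\<close> produces vectors that are again root vectors.  The subspace \<open>U\<close> stands in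
  for the quotient modules of the classical proof.
\<close>

definition engel :: "'v set \<Rightarrow> bool" where
  "engel A \<longleftrightarrow> (\<forall>Y U. Y \<subseteq> whole V \<longrightarrow> subspace U \<longrightarrow> ad_closed A Y \<longrightarrow> ad_closed A U \<longrightarrow> \<not> Y \<subseteq> U
     \<longrightarrow> (\<exists>y\<in>Y. y \<notin> U \<and> (\<forall>x\<in>A. br x y \<in> U)))"

lemma span_br_in:
  assumes "subspace U" "\<forall>x\<in>A. br x y \<in> U" "u \<in> span A"
  shows "br u y \<in> U"
  using assms(3)
  by (induction rule: span_induct_alt)
    (use assms in \<open>auto simp: br_linear subspace_0 intro!: subspace_add subspace_scale\<close>)

text \<open>
  The elements of \<open>Y\<close> that \<open>A\<close> carries into \<open>U\<close> are stable under \<open>br w\<close>, since \<open>w\<close> normalizes the span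
  of \<open>A\<close>.  By nilpotency, the iterates of \<open>br w\<close> on such an element end in \<open>U\<close>, and the last one
  outside \<open>U\<close> is carried into \<open>U\<close> by \<open>w\<close> as well.
\<close>

lemma engel_insert:
  assumes A: "A \<subseteq> root_vectors" "engel A"
    and w: "w \<in> root_vectors" "\<forall>x\<in>A. br x w \<in> span A"
  shows "engel (insert w A)"
  unfolding engel_def
proof (intro allI impI)
  fix Y U assume Y: "Y \<subseteq> whole V" and U: "subspace U"
    and clY: "ad_closed (insert w A) Y" and clU: "ad_closed (insert w A) U" and YU: "\<not> Y \<subseteq> U"
  have "ad_closed A Y" "ad_closed A U" using clY clU unfolding ad_closed_def by auto
  then obtain y where y: "y \<in> Y" "y \<notin> U" "\<forall>x\<in>A. br x y \<in> U"
    using A(2) Y U YU unfolding engel_def by blast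
  have orbit: "(br w ^^ n) y \<in> Y \<and> (\<forall>x\<in>A. br x ((br w ^^ n) y) \<in> U)" for n
  proof (induction n)
    case 0 then show ?case using y by simp
  next
    case (Suc n)
    let ?v = "(br w ^^ n) y"
    have "br x (br w ?v) \<in> U" if x: "x \<in> A" for x
    proof -
      obtain a b where ab: "x \<in> V a" "w \<in> V b"
        using A(1) x w(1) by (meson root_vectorsE subsetD)
      have "br (br x w) ?v \<in> U" using span_br_in[OF U] Suc w(2) x by blast
      moreover have "br w (br x ?v) \<in> U" using clU Suc x unfolding ad_closed_def by blast
      ultimately show ?thesis unfolding br_leibniz[OF ab]
        by (intro subspace_add[OF U] subspace_scale[OF U])
    qed
    then show ?case using Suc clY unfolding ad_closed_def by auto
  qed
  define Q where "Q n \<longleftrightarrow> (br w ^^ n) y \<in> U" for n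
  have "\<exists>n. Q n" unfolding Q_def using ad_nilpotent[OF w(1), of y] Y y(1) subspace_0[OF U] by (metis subsetD)
  then obtain n where n: "Q n" "\<And>m. m < n \<Longrightarrow> \<not> Q m" using exists_least_iff[of Q] by blast
  have "\<not> Q 0" using y(2) unfolding Q_def by simp
  then obtain m where m: "n = Suc m" using n(1) by (cases n) auto
  let ?v = "(br w ^^ m) y"
  have "?v \<notin> U" "br w ?v \<in> U" using n unfolding m Q_def by auto
  then show "\<exists>y\<in>Y. y \<notin> U \<and> (\<forall>x\<in>insert w A. br x y \<in> U)" using orbit[of m] by blast
qed

lemma br_span_right:
  assumes A: "A \<subseteq> root_vectors" and w: "w \<in> root_vectors" "\<forall>x\<in>A. br x w \<in> span A"
    and u: "u \<in> span A"
  shows "br w u \<in> span A"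
  using u
proof (induction rule: span_induct_alt)
  case base show ?case by (simp add: span_zero)
next
  case (step k x y)
  obtain a b where "w \<in> V a" "x \<in> V b"
    using A step.hyps w(1) by (meson root_vectorsE subsetD)
  then have "br w x \<in> span A"
    using w(2) step.hyps by (subst br_skew) (auto intro: span_neg span_scale)
  then show ?case using step.IH by (auto simp: br_linear intro: span_add span_scale)
qed

text \<open>
  Engel's property for \<open>A\<close>, applied to the root vectors modulo the span of \<open>A\<close>, gives an element of the
  normalizer.  For odd \<open>w\<close> the span of \<open>A\<close> and \<open>w\<close> is a subalgebra only if it contains \<open>[w, w]\<close>, which
  is why this is part of the conclusion.
\<close>

lemma exists_normalizing_root_vector:
  assumes A: "A \<subseteq> root_vectors" "engel A" "\<forall>x\<in>A. \<forall>y\<in>A. br x y \<in> span A"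
    and ne: "\<not> root_vectors \<subseteq> span A"
  shows "\<exists>w\<in>root_vectors. w \<notin> span A \<and> (\<forall>x\<in>A. br x w \<in> span A) \<and> br w w \<in> span A"
proof -
  have "ad_closed A root_vectors" unfolding ad_closed_def using A(1) root_vectors_br by blast
  moreover have "ad_closed A (span A)"
    unfolding ad_closed_def
  proof (intro ballI)
    fix x u assume "x \<in> A" "u \<in> span A"
    then show "br x u \<in> span A"
      using br_span_right[OF A(1), of x u] A(1,3) by blast
  qed
  ultimately obtain w where w: "w \<in> root_vectors" "w \<notin> span A" "\<forall>x\<in>A. br x w \<in> span A"
    using A(2) root_vectors_whole subspace_span ne unfolding engel_def by blast
  show ?thesis
  proof (cases "br w w \<in> span A")
    case True then show ?thesis using w by blast
  next
    case False
    \<comment> \<open>Replace \<open>w\<close> by its square, which is even and so has square zero.\<close>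
    obtain b where b: "w \<in> V b" using w(1) by (rule root_vectorsE)
    have "br w w \<in> V 0" using br_graded[OF b b] by (cases b) auto
    then have "br (br w w) (br w w) = - br (br w w) (br w w)"
      using br_skew[of "br w w" 0 "br w w" 0] by simp
    then have "scale 2 (br (br w w) (br w w)) = 0"
      by (metis add.right_inverse one_add_one scale_left_distrib scale_one)
    then have sq: "br (br w w) (br w w) = 0" by simp
    have "br x (br w w) \<in> span A" if x: "x \<in> A" for x
    proof -
      obtain a where "x \<in> V a" using A(1) x by (meson root_vectorsE subsetD)
      moreover have "br (br x w) w \<in> span A" using span_br_in[OF subspace_span w(3)] w(3) x by blast
      moreover have "br w (br x w) \<in> span A" using br_span_right[OF A(1) w(1,3)] w(3) x by blast
      ultimately show ?thesis using b by (subst br_leibniz) (blast intro: span_add span_scale)+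
    qed
    then show ?thesis using False sq root_vectors_br[OF w(1) w(1)] span_zero by auto
  qed
qed

text \<open>
  An independent subset of largest size with Engel's property spans, as it could otherwise be
  enlarged by a normalizing root vector.
\<close>

lemma engel_spanning_set: "\<exists>A. A \<subseteq> root_vectors \<and> engel A \<and> root_vectors \<subseteq> span A"
proof -
  obtain T where T: "finite T" "whole V \<subseteq> span T" using finite_dim by blast
  define Q where "Q n \<longleftrightarrow> (\<exists>A. A \<subseteq> root_vectors \<and> engel A \<and> (\<forall>x\<in>A. \<forall>y\<in>A. br x y \<in> span A)
    \<and> independent A \<and> card A = n)" for n
  have "engel {}" unfolding engel_def by auto
  then have "Q 0" unfolding Q_def using independent_empty by (intro exI[of _ "{}"]) auto
  moreover have "n \<le> card T" if "Q n" for n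
    using that card_independent_le[OF T] root_vectors_whole unfolding Q_def by blast
  ultimately obtain n where n: "Q n" "\<And>m. Q m \<Longrightarrow> m \<le> n"
    using Nat.ex_has_greatest_nat[of Q 0 "card T"] by blast
  then obtain A where A: "A \<subseteq> root_vectors" "engel A" "\<forall>x\<in>A. \<forall>y\<in>A. br x y \<in> span A"
    "independent A" "card A = n" unfolding Q_def by blast
  have "root_vectors \<subseteq> span A"
  proof (rule ccontr)
    assume "\<not> ?thesis"
    then obtain w where w: "w \<in> root_vectors" "w \<notin> span A" "\<forall>x\<in>A. br x w \<in> span A" "br w w \<in> span A"
      using exists_normalizing_root_vector[OF A(1-3)] by blast
    let ?B = "insert w A"
    have "engel ?B" by (rule engel_insert[OF A(1,2) w(1,3)])
    moreover have "\<forall>x\<in>?B. \<forall>y\<in>?B. br x y \<in> span ?B"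
    proof -
      have "br x y \<in> span A" if "x \<in> ?B" "y \<in> ?B" for x y
        using that A(3) w(3,4) br_span_right[OF A(1) w(1,3)] span_base by blast
      then show ?thesis using span_mono[of A ?B] by blast
    qed
    moreover have "independent ?B" using w(2) A(4) by (rule independent_insertI)
    moreover have "card ?B = Suc n"
    proof -
      have "finite A" using card_independent_le[OF T A(4)] A(1) root_vectors_whole by blast
      moreover have "w \<notin> A" using w(2) span_base by blast
      ultimately show ?thesis using A(5) by simp
    qed
    ultimately have "Q (Suc n)" unfolding Q_def using A(1) w(1) by (intro exI[of _ ?B]) auto
    then show False using n(2)[of "Suc n"] by simp
  qed
  then show ?thesis using A by blast
qed

text \<open>
  Engel's property with \<open>Y = root_vectors\<close> and \<open>U = {0}\<close> gives a root vector killed by a spanning set.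
\<close>

lemma exists_central_root_vector:
  assumes "whole V \<noteq> {0}"
  shows "\<exists>a. \<exists>z\<in>V a. z \<noteq> 0 \<and> (\<forall>y. br y z = 0)"
proof -
  obtain A where A: "A \<subseteq> root_vectors" "engel A" "root_vectors \<subseteq> span A"
    using engel_spanning_set by blast
  have "\<not> root_vectors \<subseteq> {0}"
  proof
    assume "root_vectors \<subseteq> {0}"
    then have "whole V \<subseteq> {0}"
      unfolding whole_eq_span_root_vectors by (intro span_minimal) auto
    then show False using assms by auto
  qed
  moreover have "ad_closed A root_vectors" unfolding ad_closed_def using A(1) root_vectors_br by blast
  moreover have "ad_closed A {0}" unfolding ad_closed_def by simp
  ultimately obtain z where z: "z \<in> root_vectors" "z \<noteq> 0" "\<forall>x\<in>A. br x z = 0"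
    using A(2)[unfolded engel_def, rule_format, OF root_vectors_whole subspace_single_0] by blast
  have "br y z = 0" for y
  proof -
    have "P y \<in> span A"
      using P_in[of y] span_minimal[OF A(3) subspace_span] whole_eq_span_root_vectors by auto
    then have "br (P y) z = 0"
      using span_br_in[OF subspace_single_0, of A z "P y"] z(3) by auto
    moreover have "br (P y) z = br y z" using br_P[of y z] br_P[of "P y" z] P_id[OF P_in] by simp
    ultimately show ?thesis by simp
  qed
  then show ?thesis using z by (meson root_vectorsE)
qed

end


section \<open>The odd superderivation of an odd-quadratic even-symplectic Lie superalgebra\<close>

locale total_odd_quadratic_symplectic = total_lie_superalgebra scale V br P
  for scale :: "'k::{alg_closed_field, field_char_0} \<Rightarrow> 'v::ab_group_add \<Rightarrow> 'v"
    and V br P +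
  fixes B \<omega> :: "'v \<Rightarrow> 'v \<Rightarrow> 'k"
  assumes B_product: "odd_invariant_scalar_product scale V br B"
    and \<omega>_symplectic: "even_symplectic_form scale V br \<omega>"
    and B_P: "B x y = B (P x) (P y)"
    and \<omega>_P: "\<omega> x y = \<omega> (P x) (P y)"
begin

lemma form_linear:
  assumes "bilinear_form scale V \<theta>" "\<And>x y. \<theta> x y = \<theta> (P x) (P y)"
  shows "\<theta> (x + y) z = \<theta> x z + \<theta> y z" "\<theta> z (x + y) = \<theta> z x + \<theta> z y"
    "\<theta> (scale c x) z = c * \<theta> x z" "\<theta> z (scale c x) = c * \<theta> z x"
    "\<theta> (- x) z = - \<theta> x z" "\<theta> z (- x) = - \<theta> z x"
    "\<theta> (x - y) z = \<theta> x z - \<theta> y z" "\<theta> z (x - y) = \<theta> z x - \<theta> z y"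
    "\<theta> 0 z = 0" "\<theta> z 0 = 0"
proof -
  note * = assms(1)[unfolded bilinear_form_def bilinear_on_def linear_on_def]
  have al: "\<theta> (x + y) z = \<theta> x z + \<theta> y z" for x y z
    using * P_in assms(2)[of "x + y"] assms(2)[of x z] assms(2)[of y z] by (simp add: P_add)
  have ar: "\<theta> z (x + y) = \<theta> z x + \<theta> z y" for x y z
    using * P_in assms(2)[of _ "x + y"] assms(2)[of z x] assms(2)[of z y] by (simp add: P_add)
  have sl: "\<theta> (scale c x) z = c * \<theta> x z" for c x z
    using * P_in assms(2)[of "scale c x"] assms(2)[of x z] by (simp add: P_scale)
  have sr: "\<theta> z (scale c x) = c * \<theta> z x" for c x z
    using * P_in assms(2)[of _ "scale c x"] assms(2)[of z x] by (simp add: P_scale)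
  show "\<theta> (x + y) z = \<theta> x z + \<theta> y z" "\<theta> z (x + y) = \<theta> z x + \<theta> z y"
    "\<theta> (scale c x) z = c * \<theta> x z" "\<theta> z (scale c x) = c * \<theta> z x"
    by (fact al ar sl sr)+
  show ml: "\<theta> (- x) z = - \<theta> x z" for x z using sl[of "-1" x z] by simp
  show mr: "\<theta> z (- x) = - \<theta> z x" for x z using sr[of z "-1" x] by simp
  show "\<theta> (x - y) z = \<theta> x z - \<theta> y z" using al[of x "- y" z] ml[of y z] by simp
  show "\<theta> z (x - y) = \<theta> z x - \<theta> z y" using ar[of z x "- y"] mr[of z y] by simp
  show "\<theta> 0 z = 0" "\<theta> z 0 = 0" using sl[of 0 0 z] sr[of z 0 0] by simp_all
qed

lemmas B_linear = form_linear[OF B_product[unfolded odd_invariant_scalar_product_def, THEN conjunct1] B_P]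
lemmas \<omega>_linear = form_linear[OF \<omega>_symplectic[unfolded even_symplectic_form_def, THEN conjunct1] \<omega>_P]

lemma br_P_P: "br (P x) y = br x y" "br x (P y) = br x y" "P (br x y) = br x y"
  using br_P[of "P x" y] br_P[of x "P y"] br_P[of x y] P_id P_in br_whole by auto

lemma B_P_P: "B (P x) y = B x y" "B x (P y) = B x y"
  using B_P[of "P x" y] B_P[of x "P y"] B_P[of x y] P_id P_in by auto

lemma \<omega>_P_P: "\<omega> (P x) y = \<omega> x y" "\<omega> x (P y) = \<omega> x y"
  using \<omega>_P[of "P x" y] \<omega>_P[of x "P y"] \<omega>_P[of x y] P_id P_in by auto

lemma P_parts:
  obtains x0 x1 where "P x = x0 + x1" "x0 \<in> V 0" "x1 \<in> V 1"
  using P_in wholeE by metis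

lemma B_odd: "x \<in> V a \<Longrightarrow> y \<in> V a \<Longrightarrow> B x y = 0"
  using B_product unfolding odd_invariant_scalar_product_def odd_form_def by blast

lemma \<omega>_even: "x \<in> V a \<Longrightarrow> y \<in> V b \<Longrightarrow> a \<noteq> b \<Longrightarrow> \<omega> x y = 0"
  using \<omega>_symplectic unfolding even_symplectic_form_def even_form_def by blast

lemma \<omega>_skew: "x \<in> V a \<Longrightarrow> y \<in> V b \<Longrightarrow> \<omega> x y = - (msgn (a * b) * \<omega> y x)"
  using \<omega>_symplectic unfolding even_symplectic_form_def skew_supersymmetric_def by blast

text \<open>The sign in supersymmetry only concerns pairs of odd elements, where an odd form vanishes.\<close>

lemma B_sym: "B x y = B y x"
proof -
  have hom: "B x y = B y x" if "x \<in> V a" "y \<in> V b" for x y a b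
  proof (cases "a = b")
    case True then show ?thesis using B_odd that by metis
  next
    case False
    then have "msgn (a * b) = (1::'k)" by (cases a; cases b) auto
    then show ?thesis
      using B_product that unfolding odd_invariant_scalar_product_def supersymmetric_def
      by (metis mult_1)
  qed
  obtain x0 x1 where x: "P x = x0 + x1" "x0 \<in> V 0" "x1 \<in> V 1" by (rule P_parts)
  obtain y0 y1 where y: "P y = y0 + y1" "y0 \<in> V 0" "y1 \<in> V 1" by (rule P_parts)
  show ?thesis unfolding B_P[of x y] B_P[of y x] x(1) y(1)
    using hom[OF x(2) y(2)] hom[OF x(3) y(2)] hom[OF x(2) y(3)] hom[OF x(3) y(3)]
    by (simp add: B_linear)
qed

lemma B_invariant: "B (br x y) z = B x (br y z)"
proof -
  have "B (br (P x) (P y)) (P z) = B (P x) (br (P y) (P z))"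
    using B_product P_in unfolding odd_invariant_scalar_product_def invariant_form_def by blast
  then show ?thesis by (simp add: br_P_P B_P_P)
qed

lemma B_eqI:
  assumes "u \<in> whole V" "v \<in> whole V" "\<And>c y. y \<in> V c \<Longrightarrow> B u y = B v y"
  shows "u = v"
proof -
  have "B (u - v) y = 0" if "y \<in> whole V" for y
    using that by (rule wholeE) (simp add: B_linear assms(3)[of _ 0] assms(3)[of _ 1])
  moreover have "u - v \<in> whole V" using assms whole_diff by blast
  ultimately have "u - v = 0"
    using B_product unfolding odd_invariant_scalar_product_def nondegenerate_def by blast
  then show ?thesis by simp
qed

text \<open>
  Let \<open>A\<close> be a basis.  By nondegeneracy the endomorphism that sends \<open>u\<close> to the vector with coordinates
  \<open>B u s\<close>, \<open>s \<in> A\<close>, is injective, hence onto, so the values of \<open>B u\<close> on \<open>A\<close> can be prescribed.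
\<close>

lemma B_represents_\<omega>: "\<exists>u\<in>whole V. \<forall>y. B u y = \<omega> x y"
proof -
  obtain T where T: "finite T" "whole V \<subseteq> span T" using finite_dim by blast
  obtain A where A: "A \<subseteq> whole V" "independent A" "whole V \<subseteq> span A"
    using maximal_independent_subset[of "whole V"] by blast
  have finA: "finite A" using card_independent_le[OF T A(2,1)] by blast
  define t where "t x = (\<Sum>s\<in>A. scale (B x s) s)" for x
  have lin: "Vector_Spaces.linear scale scale t"
    by unfold_locales (simp_all add: t_def B_linear sum.distrib[symmetric] scale_left_distrib
        scale_sum_right scale_right_distrib)
  have tW: "t ` whole V \<subseteq> whole V"
    using A(1) by (auto simp: t_def intro!: subspace_sum[OF subspace_whole] whole_scale)
  have ext: "B u y = \<omega> x y" if "\<And>s. s \<in> A \<Longrightarrow> B u s = \<omega> x s" for u x y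
  proof -
    have "P y \<in> span A" using P_in A(3) by blast
    then have "B u (P y) = \<omega> x (P y)"
      by (induction rule: span_induct_alt) (auto simp: B_linear \<omega>_linear that)
    then show ?thesis by (simp add: B_P_P \<omega>_P_P)
  qed
  have inj: "u = 0" if "u \<in> whole V" "t u = 0" for u
  proof -
    have "B u s = 0" if "s \<in> A" for s
      using independentD[OF A(2) finA order_refl, of "B u"] that \<open>t u = 0\<close> unfolding t_def by blast
    then have "B u y = B 0 y" for y using ext[of u 0] by (simp add: B_linear \<omega>_linear)
    then show ?thesis using that(1) by (intro B_eqI) auto
  qed
  let ?v = "\<Sum>s\<in>A. scale (\<omega> x s) s"
  have "?v \<in> whole V" using A(1) by (auto intro!: subspace_sum[OF subspace_whole] whole_scale)
  then have "?v \<in> t ` whole V" using inj_endo_surj[OF T subspace_whole lin tW inj] by simp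
  then obtain u where u: "u \<in> whole V" "t u = ?v" by (metis imageE)
  have "(\<Sum>s\<in>A. scale (B u s - \<omega> x s) s) = 0"
    using u(2) unfolding t_def by (simp add: scale_left_diff_distrib sum_subtractf)
  then have "B u s = \<omega> x s" if "s \<in> A" for s
    using independentD[OF A(2) finA order_refl, of "\<lambda>s. B u s - \<omega> x s"] that by simp
  then show ?thesis using u(1) ext by blast
qed

definition \<delta> :: "'v \<Rightarrow> 'v" where
  "\<delta> x = (SOME u. u \<in> whole V \<and> (\<forall>y. B u y = \<omega> x y))"

lemma \<delta>_whole: "\<delta> x \<in> whole V" and B_\<delta>: "B (\<delta> x) y = \<omega> x y"
  using someI_ex[of "\<lambda>u. u \<in> whole V \<and> (\<forall>y. B u y = \<omega> x y)"] B_represents_\<omega>[of x]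
  unfolding \<delta>_def by blast+

lemma \<delta>_add: "\<delta> (x + y) = \<delta> x + \<delta> y"
  by (rule B_eqI) (simp_all add: \<delta>_whole whole_add B_\<delta> B_linear \<omega>_linear)

lemma \<delta>_scale: "\<delta> (scale c x) = scale c (\<delta> x)"
  by (rule B_eqI) (simp_all add: \<delta>_whole whole_scale B_\<delta> B_linear \<omega>_linear)

lemma \<delta>_P: "\<delta> (P x) = \<delta> x"
  by (rule B_eqI) (simp_all add: \<delta>_whole B_\<delta> \<omega>_P_P)

sublocale \<delta>: linear_endo scale \<delta>
  by unfold_locales (simp_all add: \<delta>_add \<delta>_scale)

lemmas \<delta>_linear = \<delta>_add \<delta>_scale \<delta>.S_minus \<delta>.S_diff \<delta>.S_0

lemma \<delta>_graded:
  assumes x: "x \<in> V a"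
  shows "\<delta> x \<in> V (a + 1)"
proof -
  obtain u v where uv: "\<delta> x = u + v" "u \<in> V a" "v \<in> V (a + 1)"
    using \<delta>_whole[of x] by (rule wholeE) (cases a; force simp: add.commute)
  have "B u y = B 0 y" if y: "y \<in> V c" for y c
  proof (cases "c = a")
    case True then show ?thesis using B_odd uv(2) y by (simp add: B_linear)
  next
    case False
    then have c: "c = a + 1" by (cases a; cases c) auto
    have "B u y = B (\<delta> x) y" using B_odd[OF uv(3), of y] y c by (simp add: uv(1) B_linear)
    then show ?thesis using \<omega>_even[OF x y] False by (simp add: B_\<delta> B_linear)
  qed
  then have "u = 0" using uv(2) part_whole by (intro B_eqI) auto
  then show ?thesis using uv by simp
qed

lemma \<delta>_inj: "x \<in> whole V \<Longrightarrow> \<delta> x = 0 \<Longrightarrow> x = 0"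
  using \<omega>_symplectic B_\<delta>[of x] unfolding even_symplectic_form_def nondegenerate_def
  by (metis B_linear(9))

text \<open>
  Both sides vanish unless \<open>x\<close> and \<open>y\<close> have the same degree, so the sign \<open>(-1)\<^sup>|\<^sup>x\<^sup>|\<close> can be read off
  from \<open>y\<close> and \<open>x\<close> may be arbitrary.
\<close>

lemma \<delta>_skew:
  assumes y: "y \<in> V b"
  shows "B (\<delta> x) y = - (msgn b * B x (\<delta> y))"
proof -
  have hom: "B (\<delta> x) y = - (msgn b * B x (\<delta> y))" if x: "x \<in> V a" for x a
  proof (cases "a = b")
    case True
    then have "\<omega> x y = - (msgn (b * b) * \<omega> y x)" using \<omega>_skew x y by blast
    then show ?thesis using B_\<delta>[of x y] B_\<delta>[of y x] B_sym[of x "\<delta> y"] by (cases b) auto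
  next
    case False
    then have "b + 1 = a" by (cases a; cases b) auto
    then have "B x (\<delta> y) = 0" using B_odd[OF x] \<delta>_graded[OF y] by simp
    then show ?thesis using \<omega>_even[OF x y False] by (simp add: B_\<delta>)
  qed
  obtain x0 x1 where x: "P x = x0 + x1" "x0 \<in> V 0" "x1 \<in> V 1" by (rule P_parts)
  have "B (\<delta> (P x)) y = - (msgn b * B (P x) (\<delta> y))"
    using hom[OF x(2)] hom[OF x(3)] by (simp add: x(1) \<delta>_linear B_linear algebra_simps)
  then show ?thesis by (simp add: \<delta>_P B_P_P)
qed

text \<open>
  Pairing with \<open>z\<close> turns the closedness of \<open>\<omega>\<close> into the derivation rule.  Only \<open>z\<close> of the degree of
  \<open>br x y\<close> matters, the pairings with the other ones being zero by oddness of \<open>B\<close>.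
\<close>

lemma \<delta>_derivation:
  assumes x: "x \<in> V a"
  shows "\<delta> (br x y) = br (\<delta> x) y + scale (msgn a) (br x (\<delta> y))"
proof -
  have hom: "\<delta> (br x y) = br (\<delta> x) y + scale (msgn a) (br x (\<delta> y))" if y: "y \<in> V b" for y b
  proof (rule B_eqI)
    show "\<delta> (br x y) \<in> whole V" by (rule \<delta>_whole)
    show "br (\<delta> x) y + scale (msgn a) (br x (\<delta> y)) \<in> whole V"
      by (intro whole_add whole_scale br_whole)
    fix z c assume z: "z \<in> V c"
    have closed: "msgn (c * a) * \<omega> x (br y z) + msgn (a * b) * \<omega> y (br z x) + msgn (b * c) * \<omega> z (br x y) = 0"
      using \<omega>_symplectic x y z unfolding even_symplectic_form_def closed_form_def by blast
    have 1: "\<omega> x (br y z) = B (br (\<delta> x) y) z"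
      by (simp add: B_\<delta>[symmetric] B_invariant)
    have 2: "\<omega> y (br z x) = B (br x (\<delta> y)) z"
      by (metis B_\<delta> B_sym B_invariant)
    have 3: "\<omega> z (br x y) = - (msgn (c * (a + b)) * B (\<delta> (br x y)) z)"
      unfolding B_\<delta> by (rule \<omega>_skew[OF z br_graded[OF x y]])
    show "B (\<delta> (br x y)) z = B (br (\<delta> x) y + scale (msgn a) (br x (\<delta> y))) z"
    proof (cases "c = a + b")
      case True
      show ?thesis using closed unfolding 1 2 3 True
        by (cases a; cases b) (auto simp: B_linear algebra_simps)
    next
      case False
      then have "c = a + b + 1" by (cases a; cases b; cases c) auto
      then have "\<delta> (br x y) \<in> V c" "br (\<delta> x) y \<in> V c" "br x (\<delta> y) \<in> V c"
        using \<delta>_graded[OF br_graded[OF x y]] br_graded[OF \<delta>_graded[OF x] y] br_graded[OF x \<delta>_graded[OF y]]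
        by (cases a; cases b; simp)+
      then show ?thesis using B_odd z by (simp add: B_linear)
    qed
  qed
  obtain y0 y1 where y: "P y = y0 + y1" "y0 \<in> V 0" "y1 \<in> V 1" by (rule P_parts)
  have "\<delta> (br x (P y)) = br (\<delta> x) (P y) + scale (msgn a) (br x (\<delta> (P y)))"
    using hom[OF y(2)] hom[OF y(3)]
    by (simp add: y(1) \<delta>_linear br_linear scale_right_distrib algebra_simps)
  then show ?thesis by (simp add: \<delta>_P br_P_P)
qed

lemma \<delta>_\<delta>_derivation: "\<delta> (\<delta> (br x y)) = br (\<delta> (\<delta> x)) y + br x (\<delta> (\<delta> y))"
proof -
  have hom: "\<delta> (\<delta> (br x y)) = br (\<delta> (\<delta> x)) y + br x (\<delta> (\<delta> y))" if x: "x \<in> V a" for x a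
    by (cases a) (use x \<delta>_graded[OF x] in
      \<open>simp_all add: \<delta>_derivation[OF x] \<delta>_linear \<delta>_derivation[OF \<delta>_graded[OF x]]\<close>)
  obtain x0 x1 where x: "P x = x0 + x1" "x0 \<in> V 0" "x1 \<in> V 1" by (rule P_parts)
  have "\<delta> (\<delta> (br (P x) y)) = br (\<delta> (\<delta> (P x))) y + br (P x) (\<delta> (\<delta> y))"
    using hom[OF x(2)] hom[OF x(3)] by (simp add: x(1) \<delta>_linear br_linear algebra_simps)
  then show ?thesis by (simp add: \<delta>_P br_P_P)
qed

lemma \<delta>_central:
  assumes "\<And>y. br y z = 0"
  shows "br y (\<delta> z) = 0"
proof -
  have hom: "br y (\<delta> z) = 0" if "y \<in> V b" for y b
    using \<delta>_derivation[OF that, of z] assms by (simp add: \<delta>_linear msgn_def split: if_splits)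
  obtain y0 y1 where y: "P y = y0 + y1" "y0 \<in> V 0" "y1 \<in> V 1" by (rule P_parts)
  have "br (P y) (\<delta> z) = 0" using hom[OF y(2)] hom[OF y(3)] by (simp add: y(1) br_linear)
  then show ?thesis by (simp add: br_P_P)
qed

text \<open>
  The even part of the centre is stable under \<open>\<delta>\<^sup>2\<close>, and it is nonzero because \<open>\<delta>\<close> carries odd central
  elements to even ones.  The field contains a square root of the eigenvalue.
\<close>

lemma exists_central_eigenvector:
  assumes "whole V \<noteq> {0}"
  shows "\<exists>z\<in>V 0. \<exists>m. z \<noteq> 0 \<and> m \<noteq> 0 \<and> (\<forall>y. br y z = 0) \<and> \<delta> (\<delta> z) = scale (m * m) z"
proof -
  have inj: "x \<in> V a \<Longrightarrow> \<delta> x = 0 \<Longrightarrow> x = 0" for x a using \<delta>_inj part_whole by blast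
  have gr: "\<delta> (\<delta> x) \<in> V a" if "x \<in> V a" for x a
    using \<delta>_graded[OF \<delta>_graded[OF that]] by (cases a) auto
  have der: "lie_superalgebra_derivation scale V br P (\<lambda>x. \<delta> (\<delta> x))"
  proof unfold_locales
    show "\<delta> (\<delta> x) \<in> V a" if "x \<in> V a" for x a using gr[OF that] .
    show "\<delta> (\<delta> (br x y)) = br (\<delta> (\<delta> x)) y + br x (\<delta> (\<delta> y))" for x y
      by (rule \<delta>_\<delta>_derivation)
    show "x = 0" if "x \<in> V a" "\<delta> (\<delta> x) = 0" for x a
      using inj[OF that(1)] inj[OF \<delta>_graded[OF that(1)] that(2)] .
  qed (simp_all add: \<delta>_linear)
  then obtain a z where z: "z \<in> V a" "z \<noteq> 0" "\<And>y. br y z = 0"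
    using lie_superalgebra_derivation.exists_central_root_vector[OF der assms] by blast
  define Z where "Z = {z \<in> V 0. \<forall>y. br y z = 0}"
  have Z: "subspace Z"
    by (rule subspaceI) (auto simp: Z_def br_linear intro: part_add part_scale)
  have "\<exists>v\<in>Z. v \<noteq> 0"
  proof (cases a)
    case zero then show ?thesis using z unfolding Z_def by blast
  next
    case one
    then have "\<delta> z \<in> V 0" using \<delta>_graded[OF z(1)] by simp
    moreover have "br y (\<delta> z) = 0" for y by (rule \<delta>_central[OF z(3)])
    moreover have "\<delta> z \<noteq> 0" using inj z by blast
    ultimately show ?thesis unfolding Z_def by blast
  qed
  then obtain v where v: "v \<in> Z" "v \<notin> {0}" by blast
  obtain T where T: "finite T" "Z \<subseteq> span T" using finite_dim part_whole unfolding Z_def by blast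
  have endo: "linear_endo scale (\<lambda>x. \<delta> (\<delta> x))"
    by unfold_locales (simp_all add: \<delta>_linear)
  have ZZ: "(\<lambda>x. \<delta> (\<delta> x)) ` Z \<subseteq> Z"
    using gr \<delta>_central unfolding Z_def by auto
  obtain w c where w: "w \<in> Z" "w \<noteq> 0" "\<delta> (\<delta> w) = scale c w"
    using relative_eigenvector[OF endo T Z ZZ v subspace_single_0] by auto
  have "\<exists>m. poly [:- c, 0, 1:] m = 0" by (rule alg_closed_imp_poly_has_root) simp
  then obtain m where l: "m * m = c" by auto
  have "c \<noteq> 0"
  proof
    assume "c = 0"
    then have "\<delta> (\<delta> w) = 0" using w(3) by simp
    then show False using inj[OF \<delta>_graded] inj w unfolding Z_def by blast
  qed
  then show ?thesis using w l unfolding Z_def by (intro bexI[of _ w] exI[of _ m]) auto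
qed

end


section \<open>Splitting off a central plane\<close>

text \<open>
  Here \<open>f0\<close>, \<open>f1\<close> are the future \<open>e\<^sub>0\<^sup>*\<close>, \<open>e\<^sub>1\<^sup>*\<close> of the extension.
\<close>

locale split_odd_quadratic_symplectic = total_odd_quadratic_symplectic scale V br P B \<omega>
  for scale :: "'k::{alg_closed_field, field_char_0} \<Rightarrow> 'v::ab_group_add \<Rightarrow> 'v"
    and V br P B \<omega> +
  fixes f0 f1 e0 e1 :: 'v and lam :: 'k
  assumes f0: "f0 \<in> V 0" and f1: "f1 \<in> V 1" and e0: "e0 \<in> V 0" and e1: "e1 \<in> V 1"
    and br_f0 [simp]: "br x f0 = 0" and br_f1 [simp]: "br x f1 = 0"
    and \<delta>_f0: "\<delta> f0 = scale lam f1" and \<delta>_f1: "\<delta> f1 = scale lam f0" and lam: "lam \<noteq> 0"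
    and B_f0_e1 [simp]: "B f0 e1 = 1" and B_f1_e0 [simp]: "B f1 e0 = 1" and B_e0_e1 [simp]: "B e0 e1 = 0"
begin

text \<open>
  The plane is isotropic, as \<open>lam * B f1 f0 = \<omega> f0 f0\<close> and \<open>\<omega>\<close> is alternating on even vectors.
\<close>

lemma B_f0_f1 [simp]: "B f0 f1 = 0"
proof -
  have "\<omega> f0 f0 = - \<omega> f0 f0" using \<omega>_skew[OF f0 f0] by simp
  then have "B (\<delta> f0) f0 = 0" unfolding B_\<delta> by (rule eq_minus_self_zero)
  then show ?thesis using lam by (simp add: \<delta>_f0 B_linear B_sym[of f1 f0])
qed

lemma B_basis [simp]:
  "B f0 f0 = 0" "B f0 e0 = 0" "B e0 f0 = 0" "B e0 e0 = 0" "B f1 f1 = 0" "B f1 e1 = 0" "B e1 f1 = 0"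
  "B e1 e1 = 0" "B f1 f0 = 0" "B e1 e0 = 0" "B e1 f0 = 1" "B e0 f1 = 1"
  using B_odd[OF f0 f0] B_odd[OF f0 e0] B_odd[OF e0 f0] B_odd[OF e0 e0] B_odd[OF f1 f1] B_odd[OF f1 e1]
    B_odd[OF e1 f1] B_odd[OF e1 e1] B_sym[of f1 f0] B_sym[of e1 e0] B_sym[of e1 f0] B_sym[of e0 f1]
  by simp_all

lemma br_central_left: "br f0 x = 0" "br f1 x = 0"
proof -
  have hom: "br f x = 0" if "f \<in> V a" "\<And>y. br y f = 0" "x \<in> V b" for f x a b
    using br_skew[OF that(1,3)] that(2) by simp
  obtain x0 x1 where x: "P x = x0 + x1" "x0 \<in> V 0" "x1 \<in> V 1" by (rule P_parts)
  have "br f (P x) = 0" if "f \<in> V a" "\<And>y. br y f = 0" for f a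
    using hom[OF that x(2)] hom[OF that x(3)] by (simp add: x(1) br_linear)
  from this[OF f0] this[OF f1] show "br f0 x = 0" "br f1 x = 0" by (simp_all add: br_P_P)
qed
declare br_central_left [simp]

text \<open>
  The orthogonal projection along the span of \<open>f0\<close>, \<open>f1\<close>, \<open>e0\<close>, \<open>e1\<close>.
\<close>

definition proj :: "'v \<Rightarrow> 'v" where
  "proj x = P x - scale (B x e1) f0 - scale (B x e0) f1 - scale (B x f1) e0 - scale (B x f0) e1"

definition H_part :: "bit \<Rightarrow> 'v set" where
  "H_part a = {x \<in> V a. B x f0 = 0 \<and> B x f1 = 0 \<and> B x e0 = 0 \<and> B x e1 = 0}"

lemma subspace_H_part: "subspace (H_part a)"
  by (rule subspaceI) (auto simp: H_part_def B_linear part_add part_scale)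

lemma H_part_V: "x \<in> H_part a \<Longrightarrow> x \<in> V a"
  unfolding H_part_def by blast

lemma whole_H_part:
  "x \<in> whole H_part \<longleftrightarrow> x \<in> whole V \<and> B x f0 = 0 \<and> B x f1 = 0 \<and> B x e0 = 0 \<and> B x e1 = 0"
    (is "?l \<longleftrightarrow> ?r")
proof
  assume ?l
  then obtain x0 x1 where "x = x0 + x1" "x0 \<in> H_part 0" "x1 \<in> H_part 1" unfolding whole_def by blast
  then show ?r by (auto simp: H_part_def B_linear intro: whole_add_parts)
next
  assume r: ?r
  then obtain x0 x1 where x: "x = x0 + x1" "x0 \<in> V 0" "x1 \<in> V 1" by (elim conjE wholeE) blast
  have "B x0 f0 = 0" "B x0 e0 = 0" "B x1 f1 = 0" "B x1 e1 = 0"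
    using B_odd x f0 f1 e0 e1 by blast+
  then have "x0 \<in> H_part 0" "x1 \<in> H_part 1" using r x unfolding H_part_def by (auto simp: B_linear)
  then show ?l unfolding whole_def x(1) by blast
qed

lemma subspace_whole_H: "subspace (whole H_part)"
  by (rule subspaceI) (auto simp: whole_H_part B_linear whole_add whole_scale)

lemma H_part_whole_in: "x \<in> whole H_part \<Longrightarrow> x \<in> whole V"
  by (simp add: whole_H_part)

lemma H_part_whole: "x \<in> H_part a \<Longrightarrow> x \<in> whole H_part"
  using part_whole by (auto simp: whole_H_part H_part_def)

lemma whole_H_partE:
  assumes "x \<in> whole H_part"
  obtains x0 x1 where "x = x0 + x1" "x0 \<in> H_part 0" "x1 \<in> H_part 1"
  using assms unfolding whole_def by blast

lemma B_H [simp]: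
  assumes "x \<in> whole H_part"
  shows "B x f0 = 0" "B x f1 = 0" "B x e0 = 0" "B x e1 = 0"
    "B f0 x = 0" "B f1 x = 0" "B e0 x = 0" "B e1 x = 0"
  using assms B_sym[of f0 x] B_sym[of f1 x] B_sym[of e0 x] B_sym[of e1 x] by (auto simp: whole_H_part)

lemma proj_add: "proj (x + y) = proj x + proj y"
  by (simp add: proj_def P_add B_linear scale_left_distrib algebra_simps)

lemma proj_scale: "proj (scale c x) = scale c (proj x)"
  by (simp add: proj_def P_scale B_linear scale_right_diff_distrib)

sublocale proj: linear_endo scale proj
  by unfold_locales (simp_all add: proj_add proj_scale)

lemmas proj_linear = proj_add proj_scale proj.S_minus proj.S_diff proj.S_0

lemma basis_whole: "f0 \<in> whole V" "f1 \<in> whole V" "e0 \<in> whole V" "e1 \<in> whole V"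
  using f0 f1 e0 e1 part_whole by blast+

lemma proj_whole: "proj x \<in> whole H_part"
  unfolding whole_H_part proj_def using P_in basis_whole
  by (auto simp: B_linear B_P_P intro!: whole_diff whole_scale)

lemma proj_graded:
  assumes x: "x \<in> V a"
  shows "proj x \<in> H_part a"
proof -
  have "proj x \<in> V a"
  proof (cases a)
    case zero
    then have "B x e0 = 0" "B x f0 = 0" using B_odd x e0 f0 by blast+
    then show ?thesis using x zero P_id[OF part_whole[OF x]] f0 e0
      by (auto simp: proj_def intro!: part_diff part_scale)
  next
    case one
    then have "B x e1 = 0" "B x f1 = 0" using B_odd x e1 f1 by blast+
    then show ?thesis using x one P_id[OF part_whole[OF x]] f1 e1
      by (auto simp: proj_def intro!: part_diff part_scale)
  qed
  then show ?thesis using proj_whole[of x] unfolding H_part_def whole_H_part by blast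
qed

lemma proj_H [simp]: "x \<in> whole H_part \<Longrightarrow> proj x = x"
  by (simp add: proj_def P_id H_part_whole_in)

lemma proj_basis [simp]: "proj f0 = 0" "proj f1 = 0" "proj e0 = 0" "proj e1 = 0"
  by (simp_all add: proj_def P_id basis_whole)

lemma decompose:
  "x \<in> whole V \<Longrightarrow>
    x = proj x + scale (B x e1) f0 + scale (B x e0) f1 + scale (B x f1) e0 + scale (B x f0) e1"
  by (simp add: proj_def P_id)

lemma B_proj: "y \<in> whole H_part \<Longrightarrow> B (proj x) y = B x y" "y \<in> whole H_part \<Longrightarrow> B y (proj x) = B y x"
  by (simp_all add: proj_def B_linear B_P_P)

lemma B_br_center [simp]: "B (br x y) f0 = 0" "B (br x y) f1 = 0"
  by (simp_all add: B_invariant B_linear)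

text \<open>
  On the orthogonal of the central plane the projection only removes a central summand.  Brackets do
  not see it, and neither does \<open>proj \<circ> \<delta>\<close>, since \<open>\<delta>\<close> preserves the plane.
\<close>

lemma perp_decompose:
  assumes "u \<in> whole V" "B u f0 = 0" "B u f1 = 0"
  shows "u = proj u + scale (B u e1) f0 + scale (B u e0) f1"
  using decompose[OF assms(1)] assms by simp

lemma perp_proj:
  assumes "u \<in> whole V" "B u f0 = 0" "B u f1 = 0"
  shows "br x (proj u) = br x u" "br (proj u) x = br u x" "proj (\<delta> (proj u)) = proj (\<delta> u)"
proof -
  note u = perp_decompose[OF assms]
  show "br x (proj u) = br x u" by (subst (2) u) (simp add: br_linear)
  show "br (proj u) x = br u x" by (subst (2) u) (simp add: br_linear)
  show "proj (\<delta> (proj u)) = proj (\<delta> u)"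
    by (subst (2) u) (simp add: \<delta>_linear proj_linear \<delta>_f0 \<delta>_f1)
qed

lemmas br_proj = perp_proj[OF br_whole B_br_center]

lemma B_\<delta>_f0: "B (\<delta> x) f0 = - lam * B x f1" and B_\<delta>_f1: "B (\<delta> x) f1 = lam * B x f0"
  using \<delta>_skew[OF f0] \<delta>_skew[OF f1] by (simp_all add: \<delta>_f0 \<delta>_f1 B_linear)

lemma \<delta>_proj:
  assumes "u \<in> whole H_part"
  shows "br x (proj (\<delta> u)) = br x (\<delta> u)" "br (proj (\<delta> u)) x = br (\<delta> u) x"
  using assms by (auto intro!: perp_proj \<delta>_whole simp: B_\<delta>_f0 B_\<delta>_f1)

definition H_br :: "'v \<Rightarrow> 'v \<Rightarrow> 'v" where
  "H_br x y = proj (br x y)"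

lemma H_br_linear:
  "H_br (x + y) z = H_br x z + H_br y z" "H_br z (x + y) = H_br z x + H_br z y"
  "H_br (scale c x) z = scale c (H_br x z)" "H_br z (scale c x) = scale c (H_br z x)"
  "H_br (- x) z = - H_br x z" "H_br z (- x) = - H_br z x"
  "H_br (x - y) z = H_br x z - H_br y z" "H_br z (x - y) = H_br z x - H_br z y"
  by (simp_all add: H_br_def br_linear proj_linear)

lemma H_br_center [simp]: "H_br x f0 = 0" "H_br x f1 = 0" "H_br f0 x = 0" "H_br f1 x = 0"
  by (simp_all add: H_br_def proj_linear)

lemma H_br_whole: "H_br x y \<in> whole H_part"
  unfolding H_br_def by (rule proj_whole)

lemma H_br_graded: "x \<in> V a \<Longrightarrow> y \<in> V b \<Longrightarrow> H_br x y \<in> H_part (a + b)"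
  unfolding H_br_def by (intro proj_graded br_graded)

lemma H_br_skew: "x \<in> V a \<Longrightarrow> y \<in> V b \<Longrightarrow> H_br x y = - scale (msgn (a * b)) (H_br y x)"
  unfolding H_br_def by (subst br_skew[of x a y b]) (simp_all add: proj_linear)

text \<open>
  Brackets are orthogonal to the central plane, so inner projections can be dropped.  The identity
  holds with \<open>x\<close> and \<open>y\<close> outside \<open>H\<close> too; with \<open>e0\<close> and \<open>e1\<close> in their place it gives the relations
  between the maps and vectors that describe the extension.
\<close>

lemma H_br_leibniz:
  "x \<in> V a \<Longrightarrow> y \<in> V b \<Longrightarrow> H_br x (H_br y z) = H_br (H_br x y) z + scale (msgn (a * b)) (H_br y (H_br x z))"
  unfolding H_br_def br_proj by (subst br_leibniz[of x a y b]) (simp_all add: proj_linear)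

definition H_\<delta> :: "'v \<Rightarrow> 'v" where
  "H_\<delta> x = proj (\<delta> x)"

lemma H_\<delta>_linear:
  "H_\<delta> (x + y) = H_\<delta> x + H_\<delta> y" "H_\<delta> (scale c x) = scale c (H_\<delta> x)"
  by (simp_all add: H_\<delta>_def \<delta>_linear proj_linear)

lemma H_\<delta>_whole: "H_\<delta> x \<in> whole H_part"
  unfolding H_\<delta>_def by (rule proj_whole)

lemma H_\<delta>_graded: "x \<in> V a \<Longrightarrow> H_\<delta> x \<in> H_part (a + 1)"
  unfolding H_\<delta>_def by (intro proj_graded \<delta>_graded)

text \<open>
  On the right stands \<open>\<delta>\<close> itself: for \<open>e0\<close> and \<open>e1\<close> the difference between \<open>\<delta>\<close> and \<open>H_\<delta>\<close> is what
  produces the terms with \<open>lam\<close>.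
\<close>

lemma H_\<delta>_H_br:
  "x \<in> V a \<Longrightarrow> H_\<delta> (H_br x y) = H_br (\<delta> x) y + scale (msgn a) (H_br x (\<delta> y))"
  unfolding H_\<delta>_def H_br_def br_proj by (subst \<delta>_derivation[of x a]) (simp_all add: proj_linear)

lemma H_br_\<delta>: "x \<in> whole H_part \<Longrightarrow> H_br (\<delta> x) y = H_br (H_\<delta> x) y" "x \<in> whole H_part \<Longrightarrow> H_br y (\<delta> x) = H_br y (H_\<delta> x)"
  unfolding H_\<delta>_def H_br_def by (simp_all add: \<delta>_proj)

lemma B_H_br: "z \<in> whole H_part \<Longrightarrow> B (H_br x y) z = B (br x y) z" "z \<in> whole H_part \<Longrightarrow> B z (H_br x y) = B z (br x y)"
  unfolding H_br_def by (simp_all add: B_proj)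

text \<open>
  The data of the extension: \<open>k\<close> and \<open>alpha\<close> are the coefficients of \<open>f0\<close> in \<open>br e1 e1\<close> and \<open>\<delta> e1\<close>.
\<close>

definition "x0 = H_br e1 e1"
definition "x1 = H_br e0 e1"
definition "c0 = proj (\<delta> e1)"
definition "c1 = proj (\<delta> e0)"
definition "k = B (br e1 e1) e1"
definition "alpha = B (\<delta> e1) e1"

lemma coefficients_in:
  "x0 \<in> H_part 0" "x1 \<in> H_part 1" "c0 \<in> H_part 0" "c1 \<in> H_part 1"
  using H_br_graded[OF e1 e1] H_br_graded[OF e0 e1] proj_graded[OF \<delta>_graded[OF e1]] proj_graded[OF \<delta>_graded[OF e0]]
  by (simp_all add: x0_def x1_def c0_def c1_def)

lemmas coefficients_whole [simp] = coefficients_in[THEN H_part_whole]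

lemma \<delta>_e0: "\<delta> e0 = c1 - scale lam e1"
proof -
  have "\<delta> e0 \<in> V 1" using \<delta>_graded[OF e0] by simp
  then have "B (\<delta> e0) e1 = 0" "B (\<delta> e0) f1 = 0" using B_odd e1 f1 by blast+
  moreover have "B (\<delta> e0) e0 = 0"
  proof -
    have "B (\<delta> e0) e0 = - B (\<delta> e0) e0"
      using \<delta>_skew[OF e0, of e0] B_sym[of e0 "\<delta> e0"] by simp
    then show ?thesis by (rule eq_minus_self_zero)
  qed
  ultimately show ?thesis
    using decompose[OF \<delta>_whole, of e0] B_\<delta>_f0[of e0] by (simp add: c1_def)
qed

lemma \<delta>_e1: "\<delta> e1 = scale alpha f0 + c0 + scale lam e0"
proof -
  have "\<delta> e1 \<in> V 0" using \<delta>_graded[OF e1] by simp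
  then have "B (\<delta> e1) e0 = 0" "B (\<delta> e1) f0 = 0" using B_odd e0 f0 by blast+
  then show ?thesis
    using decompose[OF \<delta>_whole, of e1] B_\<delta>_f1[of e1] by (simp add: c0_def alpha_def add.commute)
qed

lemma B_br_left: "B (br x y) z = B (br z x) y"
  by (metis B_sym B_invariant)

lemma br_e0_e0: "br e0 e0 = 0"
proof -
  have "br e0 e0 = - br e0 e0" using br_skew[OF e0 e0] by simp
  then have "scale 2 (br e0 e0) = 0"
    by (metis add.right_inverse one_add_one scale_left_distrib scale_one)
  then show ?thesis by simp
qed

lemma br_e1_e0: "br e1 e0 = - br e0 e1"
  using br_skew[OF e1 e0] by simp

lemma br_e0_e1: "br e0 e1 = x1"
proof -
  have "B (br e0 e1) e1 = 0" using B_odd[OF br_graded[OF e0 e1], of e1] e1 by simp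
  moreover have "B (br e0 e1) e0 = 0" using B_br_left[of e0 e1 e0] by (simp add: br_e0_e0 B_linear)
  ultimately show ?thesis
    using perp_decompose[OF br_whole B_br_center, of e0 e1] by (simp add: x1_def H_br_def)
qed

lemma br_e1_e1: "br e1 e1 = scale k f0 + x0"
proof -
  have "B (br e1 e1) e0 = 0" using B_odd[OF br_graded[OF e1 e1], of e0] e0 by simp
  then show ?thesis
    using perp_decompose[OF br_whole B_br_center, of e1 e1] by (simp add: x0_def k_def H_br_def add.commute)
qed

text \<open>
  The coefficient of \<open>f0\<close> in a vector is its pairing with \<open>e1\<close>, that of \<open>f1\<close> its pairing with \<open>e0\<close>;
  invariance moves \<open>e1\<close> and \<open>e0\<close> into the bracket.
\<close>

lemma br_H: "Y \<in> whole H_part \<Longrightarrow>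
    br X Y = H_br X Y + scale (B (H_br e1 X) Y) f0 + scale (B (H_br e0 X) Y) f1"
  using perp_decompose[OF br_whole B_br_center, of X Y] B_br_left[of X Y e1] B_br_left[of X Y e0]
  by (simp add: H_br_def[of X] B_H_br)

lemma br_e0_H: "X \<in> whole H_part \<Longrightarrow> br e0 X = H_br e0 X - scale (B x1 X) f0"
  using br_H[of X e0]
  by (simp add: H_br_def[of e1 e0] H_br_def[of e0 e0] br_e0_e0 br_e1_e0 br_e0_e1 proj_linear B_linear)

lemma br_e1_H: "X \<in> whole H_part \<Longrightarrow> br e1 X = H_br e1 X + scale (B x0 X) f0 + scale (B x1 X) f1"
  using br_H[of X e1] by (simp add: x0_def[symmetric] x1_def[symmetric])

lemma \<delta>_H:
  assumes X: "X \<in> whole H_part"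
  shows "\<delta> X = H_\<delta> X + scale (B c0 X) f0 - scale (B c1 X) f1"
proof -
  have "B (\<delta> X) e1 = B c0 X"
    using \<delta>_skew[OF e1, of X] X B_sym[of X c0] by (simp add: \<delta>_e1 B_linear)
  moreover have "B (\<delta> X) e0 = - B c1 X"
    using \<delta>_skew[OF e0, of X] X B_sym[of X c1] by (simp add: \<delta>_e0 B_linear)
  ultimately show ?thesis
    using perp_decompose[OF \<delta>_whole, of X] X by (simp add: B_\<delta>_f0 B_\<delta>_f1 H_\<delta>_def)
qed

text \<open>
  The maps vanish outside \<open>H\<close>, so that a trivial \<open>H\<close> is equal, and not only isomorphic, to
  \<open>null_superalgebra\<close>.
\<close>

definition H :: "('k, 'v) qs_superalgebra" where
  "H = \<lparr>part = H_part,
    bracket = (\<lambda>x y. if x \<in> whole H_part \<and> y \<in> whole H_part then H_br x y else 0),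
    bform = (\<lambda>x y. if x \<in> whole H_part \<and> y \<in> whole H_part then B x y else 0),
    sform = (\<lambda>x y. if x \<in> whole H_part \<and> y \<in> whole H_part then \<omega> x y else 0)\<rparr>"

lemma H_simps [simp]:
  "part H = H_part"
  "x \<in> whole H_part \<Longrightarrow> y \<in> whole H_part \<Longrightarrow> bracket H x y = H_br x y"
  "x \<in> whole H_part \<Longrightarrow> y \<in> whole H_part \<Longrightarrow> bform H x y = B x y"
  "x \<in> whole H_part \<Longrightarrow> y \<in> whole H_part \<Longrightarrow> sform H x y = \<omega> x y"
  by (simp_all add: H_def)

lemmas H_add = subspace_add[OF subspace_whole_H]
lemmas H_scale = subspace_scale[OF subspace_whole_H]

lemma H_lie_superalgebra: "lie_superalgebra scale H_part (bracket H)"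
proof unfold_locales
  show "subspace (H_part a)" for a by (rule subspace_H_part)
  show "H_part 0 \<inter> H_part 1 = {0}"
  proof
    show "H_part 0 \<inter> H_part 1 \<subseteq> {0}" using independent_parts H_part_V by blast
    show "{0} \<subseteq> H_part 0 \<inter> H_part 1" using subspace_0[OF subspace_H_part] by simp
  qed
  show "\<exists>S. finite S \<and> whole H_part \<subseteq> span S"
  proof -
    obtain T where "finite T" "whole V \<subseteq> span T" using finite_dim by blast
    then show ?thesis using H_part_whole_in by (intro exI[of _ T]) auto
  qed
  show "bilinear_on scale scale (whole H_part) (bracket H)"
    unfolding bilinear_on_def linear_on_def by (simp add: H_add H_scale H_br_linear)
next
  fix x y a b assume x: "x \<in> H_part a" and y: "y \<in> H_part b"
  note [simp] = H_part_whole[OF x] H_part_whole[OF y]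
  show "bracket H x y \<in> H_part (a + b)" using H_br_graded H_part_V x y by simp
  show "bracket H x y = - scale (msgn (a * b)) (bracket H y x)"
    using H_br_skew[OF H_part_V[OF x] H_part_V[OF y]] by simp
next
  fix x y z a b c assume x: "x \<in> H_part a" and y: "y \<in> H_part b" and z: "z \<in> H_part c"
  note V = x[THEN H_part_V] y[THEN H_part_V] z[THEN H_part_V]
  note [simp] = H_part_whole[OF x] H_part_whole[OF y] H_part_whole[OF z] H_br_whole
  have 1: "H_br z x = - scale (msgn (c * a)) (H_br x z)"
    by (rule H_br_skew[OF V(3,1)])
  have 2: "H_br z (H_br x y) = - scale (msgn (c * (a + b))) (H_br (H_br x y) z)"
    by (rule H_br_skew[OF V(3) H_part_V[OF H_br_graded[OF V(1,2)]]])
  have 3: "bracket H x (bracket H y z) = H_br x (H_br y z)" "bracket H y (bracket H z x) = H_br y (H_br z x)"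
    "bracket H z (bracket H x y) = H_br z (H_br x y)" by simp_all
  show "scale (msgn (a * c)) (bracket H x (bracket H y z)) + scale (msgn (a * b)) (bracket H y (bracket H z x))
        + scale (msgn (b * c)) (bracket H z (bracket H x y)) = 0"
    using H_br_leibniz[OF V(1,2), of z] unfolding 3 2 unfolding 1
    by (cases a; cases b; cases c) (simp_all add: H_br_linear)
qed

lemma H_bform: "odd_invariant_scalar_product scale H_part (bracket H) (bform H)"
  unfolding odd_invariant_scalar_product_def
proof (intro conjI)
  show "bilinear_form scale H_part (bform H)"
    unfolding bilinear_form_def bilinear_on_def linear_on_def by (simp add: H_add H_scale B_linear)
  show "odd_form H_part (bform H)"
    unfolding odd_form_def by (simp add: H_part_whole B_odd[OF H_part_V H_part_V])
  show "supersymmetric H_part (bform H)"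
    unfolding supersymmetric_def
  proof (intro allI ballI)
    fix a b x y assume x: "x \<in> H_part a" and y: "y \<in> H_part b"
    show "bform H x y = msgn (a * b) * bform H y x"
      using B_sym[of x y] B_odd[OF H_part_V[OF x], of y] H_part_V[OF y] H_part_whole[OF x] H_part_whole[OF y]
      by (cases a; cases b) auto
  qed
  show "invariant_form H_part (bracket H) (bform H)"
    unfolding invariant_form_def by (simp add: H_br_whole B_H_br B_invariant)
  show "nondegenerate H_part (bform H)"
    unfolding nondegenerate_def
  proof (intro ballI impI)
    fix x assume x: "x \<in> whole H_part" and 0: "\<forall>y\<in>whole H_part. bform H x y = 0"
    have "B x y = B 0 y" for y
    proof -
      have "B x (proj y) = 0" using 0 x proj_whole[of y] by auto
      then show ?thesis using x by (simp add: B_proj B_linear)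
    qed
    then show "x = 0" using B_eqI[of x 0] H_part_whole_in[OF x] by simp
  qed
qed

lemma H_\<delta>_inj:
  assumes x: "x \<in> whole H_part" and 0: "H_\<delta> x = 0"
  shows "x = 0"
proof -
  \<comment> \<open>Then \<open>\<delta> x\<close> lies in the central plane, which \<open>\<delta>\<close> maps onto itself.\<close>
  have "\<delta> x = scale (B c0 x) f0 - scale (B c1 x) f1" using \<delta>_H[OF x] 0 by simp
  then have "\<delta> (x - (scale (B c0 x / lam) f1 - scale (B c1 x / lam) f0)) = 0"
    using lam by (simp add: \<delta>_linear \<delta>_f0 \<delta>_f1)
  then have "x = scale (B c0 x / lam) f1 - scale (B c1 x / lam) f0"
    using \<delta>_inj[of "x - (scale (B c0 x / lam) f1 - scale (B c1 x / lam) f0)"] H_part_whole_in[OF x]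
      basis_whole by (simp add: whole_diff whole_scale)
  then have "proj x = proj (scale (B c0 x / lam) f1 - scale (B c1 x / lam) f0)" by simp
  then show ?thesis using x by (simp add: proj_linear)
qed

lemma \<omega>_H: "x \<in> whole H_part \<Longrightarrow> y \<in> whole H_part \<Longrightarrow> \<omega> x y = B (H_\<delta> x) y"
  unfolding H_\<delta>_def by (simp add: B_proj B_\<delta>)

lemma H_associated: "associated_superderivation scale H H_\<delta>"
  unfolding associated_superderivation_def
proof (intro conjI)
  show "superderivation scale (part H) (bracket H) 1 H_\<delta>"
    unfolding superderivation_def
  proof (intro conjI allI ballI)
    show "linear_on scale scale (whole (part H)) H_\<delta>"
      unfolding linear_on_def by (simp add: H_\<delta>_linear)
    show "H_\<delta> ` part H a \<subseteq> part H (a + 1)" for a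
      using H_\<delta>_graded[OF H_part_V, of _ a] by (simp add: image_subset_iff)
    fix a b x y assume "x \<in> part H a" "y \<in> part H b"
    then show "H_\<delta> (bracket H x y) = bracket H (H_\<delta> x) y + scale (msgn (1 * a)) (bracket H x (H_\<delta> y))"
      using H_\<delta>_H_br[of x a y] H_part_V[of x a] H_part_whole[of x a] H_part_whole[of y b]
      by (simp add: H_\<delta>_whole H_br_\<delta>)
  qed
  have h: "H_\<delta> ` whole H_part \<subseteq> whole H_part" using H_\<delta>_whole by blast
  obtain T where T: "finite T" "whole V \<subseteq> span T" using finite_dim by blast
  have lin: "Vector_Spaces.linear scale scale H_\<delta>"
    by unfold_locales (simp_all add: H_\<delta>_linear scale_right_distrib scale_left_distrib)
  have "H_\<delta> ` whole H_part = whole H_part"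
    using inj_endo_surj[OF T(1) _ subspace_whole_H lin h H_\<delta>_inj] T(2) H_part_whole_in by blast
  moreover have "inj_on H_\<delta> (whole H_part)"
  proof (rule inj_onI)
    fix x y assume xy: "x \<in> whole H_part" "y \<in> whole H_part" "H_\<delta> x = H_\<delta> y"
    have "H_\<delta> (x + scale (-1) y) = 0" using xy(3) by (simp only: H_\<delta>_linear) simp
    then have "x + scale (-1) y = 0" using H_\<delta>_inj xy H_add H_scale by blast
    then show "x = y" by simp
  qed
  ultimately show "bij_betw H_\<delta> (whole (part H)) (whole (part H))" unfolding bij_betw_def by simp
  show "\<forall>x\<in>whole (part H). \<forall>y\<in>whole (part H). sform H x y = bform H (H_\<delta> x) y"
    by (simp add: H_\<delta>_whole \<omega>_H)
qed

lemma \<omega>_H_br: "x \<in> whole H_part \<Longrightarrow> \<omega> x (H_br y z) = \<omega> x (br y z)"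
proof -
  assume x: "x \<in> whole H_part"
  have "br y z = H_br y z + scale (B (br y z) e1) f0 + scale (B (br y z) e0) f1"
    unfolding H_br_def by (rule perp_decompose) (simp_all add: br_whole)
  then have "\<omega> x (br y z) = \<omega> x (H_br y z + scale (B (br y z) e1) f0 + scale (B (br y z) e0) f1)"
    by simp
  then show ?thesis using x by (simp add: \<omega>_linear B_\<delta>[symmetric] B_linear B_\<delta>_f0 B_\<delta>_f1)
qed

lemma H_sform: "even_symplectic_form scale H_part (bracket H) (sform H)"
  unfolding even_symplectic_form_def
proof (intro conjI)
  show "bilinear_form scale H_part (sform H)"
    unfolding bilinear_form_def bilinear_on_def linear_on_def by (simp add: H_add H_scale \<omega>_linear)
  show "even_form H_part (sform H)"
    unfolding even_form_def by (simp add: H_part_whole \<omega>_even[OF H_part_V H_part_V])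
  show "skew_supersymmetric H_part (sform H)"
    unfolding skew_supersymmetric_def
  proof (intro allI ballI)
    fix a b x y assume x: "x \<in> H_part a" and y: "y \<in> H_part b"
    show "sform H x y = - (msgn (a * b) * sform H y x)"
      using H_part_whole[OF x] H_part_whole[OF y] \<omega>_skew[OF H_part_V[OF x] H_part_V[OF y]] by simp
  qed
  show "closed_form H_part (bracket H) (sform H)"
    unfolding closed_form_def
  proof (intro allI ballI)
    fix a b c x y z assume x: "x \<in> H_part a" and y: "y \<in> H_part b" and z: "z \<in> H_part c"
    have "msgn (c * a) * \<omega> x (br y z) + msgn (a * b) * \<omega> y (br z x) + msgn (b * c) * \<omega> z (br x y) = 0"
      using \<omega>_symplectic H_part_V[OF x] H_part_V[OF y] H_part_V[OF z]
      unfolding even_symplectic_form_def closed_form_def by blast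
    then show "msgn (c * a) * sform H x (bracket H y z) + msgn (a * b) * sform H y (bracket H z x)
        + msgn (b * c) * sform H z (bracket H x y) = 0"
      using H_part_whole[OF x] H_part_whole[OF y] H_part_whole[OF z] by (simp add: H_br_whole \<omega>_H_br)
  qed
  show "nondegenerate H_part (sform H)"
    unfolding nondegenerate_def
  proof (intro ballI impI)
    fix x assume x: "x \<in> whole H_part" and 0: "\<forall>y\<in>whole H_part. sform H x y = 0"
    have "bform H (H_\<delta> x) y = 0" if "y \<in> whole H_part" for y
      using 0 x that by (simp add: H_\<delta>_whole \<omega>_H)
    then have "H_\<delta> x = 0"
      using H_bform H_\<delta>_whole unfolding odd_invariant_scalar_product_def nondegenerate_def by blast
    then show "x = 0" by (rule H_\<delta>_inj[OF x])
  qed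
qed

lemma H_odd_quadratic_even_symplectic: "odd_quadratic_even_symplectic scale H"
  unfolding odd_quadratic_even_symplectic_def
  using H_lie_superalgebra H_bform H_sform by simp

end


section \<open>The algebra as an extension of the complement\<close>

context split_odd_quadratic_symplectic
begin

definition E :: "('k, 'v) ext_data" where
  "E = \<lparr>eD = H_br e0, eDb = H_br e1, ex0 = x0, ex1 = x1, ec0 = c0, ec1 = c1, ek = k, ealpha = alpha, elam = lam\<rparr>"

lemma E_simps [simp]:
  "eD E = H_br e0" "eDb E = H_br e1" "ex0 E = x0" "ex1 E = x1" "ec0 E = c0" "ec1 E = c1" "ek E = k"
  "ealpha E = alpha" "elam E = lam"
  by (simp_all add: E_def)

lemma superderivation_H_br:
  assumes e: "e \<in> V d"
  shows "superderivation scale H_part (bracket H) d (H_br e)"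
  unfolding superderivation_def
proof (intro conjI allI ballI)
  show "linear_on scale scale (whole H_part) (H_br e)"
    unfolding linear_on_def by (simp add: H_br_linear)
  show "H_br e ` H_part a \<subseteq> H_part (a + d)" for a
  proof
    fix y assume "y \<in> H_br e ` H_part a"
    then have "y \<in> H_part (d + a)" using H_br_graded[OF e H_part_V] by blast
    then show "y \<in> H_part (a + d)" by (simp only: add.commute)
  qed
  fix a b x y assume x: "x \<in> H_part a" and y: "y \<in> H_part b"
  show "H_br e (bracket H x y) = bracket H (H_br e x) y + scale (msgn (d * a)) (bracket H x (H_br e y))"
    using H_br_leibniz[OF e H_part_V[OF x], of y] H_part_whole[OF x] H_part_whole[OF y] by (simp add: H_br_whole)
qed

lemma skew_supersymmetric_H_br:
  assumes e: "e \<in> V d"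
  shows "skew_supersymmetric_map H_part (bform H) d (H_br e)"
  unfolding skew_supersymmetric_map_def
proof (intro allI ballI)
  fix a b x y assume x: "x \<in> H_part a" and y: "y \<in> H_part b"
  have "B x (br e y) = - (msgn (a * d) * B (br e x) y)"
    using br_skew[OF H_part_V[OF x] e] by (simp add: B_invariant[symmetric] B_linear)
  then show "bform H (H_br e x) y = - (msgn (d * a) * bform H x (H_br e y))"
    using H_part_whole[OF x] H_part_whole[OF y]
    by (cases a; cases d) (simp_all add: H_br_whole B_H_br)
qed

lemma H_br_e1_e0: "H_br e1 e0 = - x1" and H_br_e0_e0: "H_br e0 e0 = 0"
  by (simp_all add: H_br_def br_e1_e0 br_e0_e0 br_e0_e1 proj_linear)

lemma H_br_\<delta>_e0: "H_br (\<delta> e0) y = H_br c1 y - scale lam (H_br e1 y)"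
  "H_br y (\<delta> e0) = H_br y c1 - scale lam (H_br y e1)"
  by (simp_all add: \<delta>_e0 H_br_linear)

lemma H_br_\<delta>_e1: "H_br (\<delta> e1) y = H_br c0 y + scale lam (H_br e0 y)"
  "H_br y (\<delta> e1) = H_br y c0 + scale lam (H_br y e0)"
  by (simp_all add: \<delta>_e1 H_br_linear)

lemma double_cancel: "scale 2 x = y \<Longrightarrow> x = scale (1 / 2) y"
  by auto

lemma triple_zero: "x + x + x = 0 \<Longrightarrow> x = 0" for x :: 'v
proof -
  assume "x + x + x = 0"
  then have "scale 3 x = 0"
    using scale_left_distrib[of "1 + 1" 1 x] scale_left_distrib[of 1 1 x] by simp
  then show ?thesis by simp
qed

lemma scale_two: "scale 2 x = x + x"
  using scale_left_distrib[of 1 1 x] by simp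

text \<open>
  The Jacobi identity for \<open>e1\<close>, \<open>e1\<close> and \<open>x\<close>.
\<close>

lemma H_br_e1_squared: "H_br e1 (H_br e1 x) = scale (1 / 2) (H_br x0 x)"
proof (rule double_cancel)
  show "scale 2 (H_br e1 (H_br e1 x)) = H_br x0 x"
    using H_br_leibniz[OF e1 e1, of x] by (simp add: scale_two x0_def algebra_simps)
qed

lemma H_br_e1_x0: "H_br e1 x0 = 0"
proof (rule triple_zero)
  have "H_br x0 e1 = - H_br e1 x0"
    using H_br_skew[OF H_part_V[OF coefficients_in(1)] e1] by simp
  then show "H_br e1 x0 + H_br e1 x0 + H_br e1 x0 = 0"
    using H_br_leibniz[OF e1 e1, of e1] by (simp add: x0_def[symmetric] algebra_simps)
qed

lemma H_br_x1_e1: "H_br x1 e1 = H_br e1 x1"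
  using H_br_skew[OF H_part_V[OF coefficients_in(2)] e1] by simp

lemma H_br_e0_x0: "H_br e0 x0 = scale 2 (H_br e1 x1)"
  using H_br_leibniz[OF e0 e1, of e1] H_br_x1_e1
  by (simp add: x0_def[symmetric] x1_def[symmetric] scale_two)

text \<open>
  Invariance evaluates \<open>B e1 [e0, [e1, e1]]\<close> both as \<open>2 B x0 x1\<close>, through \<open>[e0, [e1, e1]] = 2 [e1, x1]\<close>, and
  as \<open>- B x0 x1\<close>.
\<close>

lemma B_x0_x1: "B x0 x1 = 0"
proof -
  have 1: "B x0 x1 = B e1 (br e1 x1)"
  proof -
    have "B (br e1 e1) x1 = B x0 x1" by (simp add: br_e1_e1 B_linear)
    then show ?thesis by (simp add: B_invariant)
  qed
  have "br x1 e1 = br e1 x1"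
    using br_skew[OF H_part_V[OF coefficients_in(2)] e1] by simp
  then have "br e0 (br e1 e1) = br e1 x1 + br e1 x1"
    using br_leibniz[OF e0 e1, of e1] by (simp add: br_e0_e1)
  then have "B e1 (br e0 (br e1 e1)) = 2 * B x0 x1" using 1 by (simp add: B_linear)
  moreover have "B e1 (br e0 (br e1 e1)) = - B x0 x1"
  proof -
    have "B e1 (br e0 (br e1 e1)) = B (br e1 e0) (br e1 e1)" by (simp add: B_invariant)
    also have "\<dots> = - B x1 x0" by (simp add: br_e1_e0 br_e0_e1 br_e1_e1 B_linear)
    finally show ?thesis using B_sym[of x1 x0] by simp
  qed
  ultimately have "3 * B x0 x1 = 0" by simp
  then show ?thesis by simp
qed

text \<open>
  The derivation rule applied to \<open>[e1, e1]\<close>; the same rule applied to \<open>[e0, e1]\<close> gives the next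
  identity.
\<close>

lemma H_\<delta>_x0: "H_\<delta> x0 = - scale 2 (H_br e1 c0) + scale (2 * lam) x1"
proof -
  have "H_br c0 e1 = - H_br e1 c0"
    using H_br_skew[OF H_part_V[OF coefficients_in(3)] e1] by simp
  moreover have "scale (2 * lam) x1 = scale lam x1 + scale lam x1"
    by (simp flip: scale_left_distrib)
  ultimately show ?thesis
    using H_\<delta>_H_br[OF e1, of e1]
    by (simp add: x0_def[symmetric] H_br_\<delta>_e1 H_br_e1_e0 x1_def[symmetric] scale_two)
qed

lemma H_\<delta>_x1: "H_\<delta> x1 = H_br e0 c0 + H_br e1 c1 - scale lam x0"
proof -
  have "H_br c1 e1 = H_br e1 c1"
    using H_br_skew[OF H_part_V[OF coefficients_in(4)] e1] by simp
  then show ?thesis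
    using H_\<delta>_H_br[OF e0, of e1]
    by (simp add: x1_def[symmetric] x0_def[symmetric] H_br_\<delta>_e0 H_br_\<delta>_e1 H_br_e0_e0)
qed

text \<open>
  Compares the coefficient of \<open>f1\<close> on both sides of \<open>\<delta> [e1, e1] = - 2 [e1, \<delta> e1]\<close>.
\<close>

lemma lam_k: "lam * k = B c1 x0 - 2 * B x1 c0"
proof -
  have "B (\<delta> (br e1 e1)) e0 = lam * k - B c1 x0"
    by (simp add: br_e1_e1 \<delta>_linear \<delta>_f0 \<delta>_H[of x0] B_linear H_\<delta>_whole)
  moreover have "B (\<delta> (br e1 e1)) e0 = - 2 * B x1 c0"
  proof -
    have "br (\<delta> e1) e1 = - br e1 (\<delta> e1)"
      using br_skew[OF \<delta>_graded[OF e1] e1] by simp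
    then have "\<delta> (br e1 e1) = scale (- 2) (br e1 (\<delta> e1))"
      using \<delta>_derivation[OF e1, of e1] by (simp add: scale_two)
    moreover have "B (br e1 (\<delta> e1)) e0 = B x1 c0"
      by (simp add: \<delta>_e1 br_linear B_linear br_e1_e0 br_e0_e1 br_e1_H H_br_whole)
    ultimately show ?thesis by (simp add: B_linear)
  qed
  ultimately show ?thesis by (simp add: algebra_simps)
qed

lemma E_admissible: "admissible_data scale H H_\<delta> E"
  unfolding admissible_data_def E_simps H_simps(1)
proof (intro conjI ballI)
  show "superderivation scale H_part (bracket H) 0 (H_br e0)"
    "skew_supersymmetric_map H_part (bform H) 0 (H_br e0)"
    "superderivation scale H_part (bracket H) 1 (H_br e1)"
    "skew_supersymmetric_map H_part (bform H) 1 (H_br e1)"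
    by (fact superderivation_H_br[OF e0] skew_supersymmetric_H_br[OF e0]
        superderivation_H_br[OF e1] skew_supersymmetric_H_br[OF e1])+
  show "x0 \<in> H_part 0" "c0 \<in> H_part 0" "x1 \<in> H_part 1" "c1 \<in> H_part 1" "lam \<noteq> 0"
    by (fact coefficients_in lam)+
  show "H_br e1 x0 = 0" by (rule H_br_e1_x0)
  show "H_br e0 x0 = scale 2 (H_br e1 x1)" by (rule H_br_e0_x0)
  show "bform H x0 x1 = 0" by (simp add: B_x0_x1)
  show "H_\<delta> x0 = - scale 2 (H_br e1 c0) + scale (2 * lam) x1" by (rule H_\<delta>_x0)
  show "H_\<delta> x1 = H_br e0 c0 + H_br e1 c1 - scale lam x0" by (rule H_\<delta>_x1)
  show "lam * k = bform H c1 x0 - 2 * bform H x1 c0" by (simp add: lam_k)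
next
  fix x assume x: "x \<in> whole H_part"
  show "H_br e1 (H_br e1 x) = scale (1 / 2) (bracket H x0 x)"
    using x by (simp add: H_br_e1_squared)
  show "supercomm scale 0 1 (H_br e0) (H_br e1) x = bracket H x1 x"
    using x H_br_leibniz[OF e0 e1, of x] by (simp add: supercomm_def x1_def[symmetric])
  show "bracket H c0 x = supercomm scale 1 1 H_\<delta> (H_br e1) x - scale lam (H_br e0 x)"
    using x H_\<delta>_H_br[OF e1, of x] by (simp add: supercomm_def H_br_\<delta>_e1 H_br_\<delta>)
  show "bracket H c1 x = supercomm scale 1 0 H_\<delta> (H_br e0) x + scale lam (H_br e1 x)"
    using x H_\<delta>_H_br[OF e0, of x] by (simp add: supercomm_def H_br_\<delta>_e0 H_br_\<delta>)
qed

fun \<phi> :: "('k, 'v) ext \<Rightarrow> 'v" where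
  "\<phi> (p0, p1, X, q0, q1) = scale p0 f0 + scale p1 f1 + X + scale q0 e0 + scale q1 e1"

lemma \<phi>_add: "\<phi> (u + v) = \<phi> u + \<phi> v"
  by (cases u; cases v) (simp add: scale_left_distrib algebra_simps)

lemma \<phi>_scale: "\<phi> (ext_scale scale c u) = scale c (\<phi> u)"
  by (cases u) (simp add: scale_right_distrib)

lemma \<phi>_diff: "\<phi> (u - v) = \<phi> u - \<phi> v"
  using \<phi>_add[of "u - v" v] by simp

lemma whole_ext: "whole (ext_part H_part :: bit \<Rightarrow> ('k, 'v) ext set) = {(p0, p1, X, q0, q1) | p0 p1 X q0 q1. X \<in> whole H_part}"
proof (intro equalityI subsetI)
  fix u :: "('k, 'v) ext" assume "u \<in> whole (ext_part H_part)"
  then obtain a b where ab: "u = a + b" "a \<in> ext_part H_part 0" "b \<in> ext_part H_part 1"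
    unfolding whole_def by blast
  obtain p0 X0 q0 where a: "a = (p0, 0, X0, q0, 0)" "X0 \<in> H_part 0"
    using ab(2) unfolding ext_part_def by auto
  obtain p1 X1 q1 where b: "b = (0, p1, X1, 0, q1)" "X1 \<in> H_part 1"
    using ab(3) unfolding ext_part_def by auto
  have "X0 + X1 \<in> whole H_part" using a b unfolding whole_def by blast
  then show "u \<in> {(p0, p1, X, q0, q1) | p0 p1 X q0 q1. X \<in> whole H_part}"
    unfolding ab(1) a(1) b(1) by simp
next
  fix u :: "('k, 'v) ext" assume "u \<in> {(p0, p1, X, q0, q1) | p0 p1 X q0 q1. X \<in> whole H_part}"
  then obtain p0 p1 X q0 q1 where u: "u = (p0, p1, X, q0, q1)" "X \<in> whole H_part" by blast
  obtain X0 X1 where X: "X = X0 + X1" "X0 \<in> H_part 0" "X1 \<in> H_part 1" using u(2) by (rule whole_H_partE)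
  have "u = (p0, 0, X0, q0, 0) + (0, p1, X1, 0, q1)" unfolding u X by simp
  moreover have "(p0, 0, X0, q0, 0) \<in> ext_part H_part 0" "(0, p1, X1, 0, q1) \<in> ext_part H_part 1"
    using X unfolding ext_part_def by auto
  ultimately show "u \<in> whole (ext_part H_part)" unfolding whole_def by blast
qed

lemma \<phi>_part: "\<phi> ` ext_part H_part a \<subseteq> V a"
  using f0 f1 e0 e1 H_part_V[of _ a]
  by (cases a) (auto simp: ext_part_def intro!: part_add part_scale)

lemma \<phi>_bij: "bij_betw \<phi> (whole (ext_part H_part)) (whole V)"
proof (rule bij_betw_byWitness[where f' = "\<lambda>x. (B x e1, B x e0, proj x, B x f1, B x f0)"])
  show "\<forall>u\<in>whole (ext_part H_part). (B (\<phi> u) e1, B (\<phi> u) e0, proj (\<phi> u), B (\<phi> u) f1, B (\<phi> u) f0) = u"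
    by (auto simp: whole_ext B_linear proj_linear)
  show "\<forall>x\<in>whole V. \<phi> (B x e1, B x e0, proj x, B x f1, B x f0) = x"
  proof
    fix x assume "x \<in> whole V"
    from decompose[OF this] show "\<phi> (B x e1, B x e0, proj x, B x f1, B x f0) = x"
      by (simp add: add_ac)
  qed
  show "\<phi> ` whole (ext_part H_part) \<subseteq> whole V"
    using basis_whole by (auto simp: whole_ext H_part_whole_in intro!: whole_add whole_scale)
  show "(\<lambda>x. (B x e1, B x e0, proj x, B x f1, B x f0)) ` whole V \<subseteq> whole (ext_part H_part)"
    by (auto simp: whole_ext proj_whole)
qed

lemma parity_inv_parts:
  assumes "X0 \<in> H_part 0" "X1 \<in> H_part 1"
  shows "parity_inv H_part (X0 + X1) = X0 - X1"
proof -
  have "hpart H_part 0 (X0 + X1) = X0"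
    unfolding hpart_def
  proof (rule the_equality)
    show "X0 \<in> H_part 0 \<and> X0 + X1 - X0 \<in> H_part (0 + 1)" using assms by simp
    fix y assume "y \<in> H_part 0 \<and> X0 + X1 - y \<in> H_part (0 + 1)"
    then have y: "y \<in> V 0" "X0 + X1 - y \<in> V 1" using H_part_V[of _ 0] H_part_V[of _ 1] by simp_all
    have "y + (X0 + X1 - y) = X0 + X1" by simp
    from parts_unique[OF this y assms[THEN H_part_V]] show "y = X0" by (rule conjunct1)
  qed
  moreover have "hpart H_part 1 (X0 + X1) = X1"
    unfolding hpart_def
  proof (rule the_equality)
    show "X1 \<in> H_part 1 \<and> X0 + X1 - X1 \<in> H_part (1 + 1)" using assms by simp
    fix y assume "y \<in> H_part 1 \<and> X0 + X1 - y \<in> H_part (1 + 1)"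
    then have y: "X0 + X1 - y \<in> V 0" "y \<in> V 1" using H_part_V[of _ 0] H_part_V[of _ 1] by simp_all
    have "X0 + X1 - y + y = X0 + X1" by simp
    from parts_unique[OF this y assms[THEN H_part_V]] show "y = X1" by (rule conjunct2)
  qed
  ultimately show ?thesis unfolding parity_inv_def by simp
qed

lemma br_H_e0: "X \<in> whole H_part \<Longrightarrow> br X e0 = - br e0 X"
proof (erule whole_H_partE)
  fix X0 X1 assume "X = X0 + X1" "X0 \<in> H_part 0" "X1 \<in> H_part 1"
  then show "br X e0 = - br e0 X"
    using br_skew[OF H_part_V e0, of X0 0] br_skew[OF H_part_V e0, of X1 1] by (simp add: br_linear)
qed

lemma br_H_e1: "X \<in> whole H_part \<Longrightarrow> br X e1 = - br e1 (parity_inv H_part X)"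
proof (erule whole_H_partE)
  fix X0 X1 assume "X = X0 + X1" "X0 \<in> H_part 0" "X1 \<in> H_part 1"
  then show "br X e1 = - br e1 (parity_inv H_part X)"
    using br_skew[OF H_part_V e1, of X0 0] br_skew[OF H_part_V e1, of X1 1]
    by (simp add: br_linear parity_inv_parts)
qed

lemma parity_inv_whole: "X \<in> whole H_part \<Longrightarrow> parity_inv H_part X \<in> whole H_part"
  by (erule whole_H_partE)
    (simp add: parity_inv_parts subspace_diff[OF subspace_whole_H H_part_whole H_part_whole])

lemma \<phi>_brackets:
  assumes "X \<in> whole H_part" "Y \<in> whole H_part"
  shows "\<phi> (ext_hh H E X Y) = br X Y" "\<phi> (ext_e0 H E X) = br e0 X" "\<phi> (ext_e1 H E X) = br e1 X"
  using assms br_H[of Y X] br_e0_H[of X] br_e1_H[of X]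
  by (simp_all add: ext_hh_def ext_e0_def ext_e1_def H_br_whole algebra_simps)

text \<open>
  The map \<open>\<phi>\<close> takes the brackets that define the extension to the corresponding brackets of the given
  algebra, so both sides agree after bilinear expansion.
\<close>

lemma \<phi>_bracket:
  assumes "u \<in> whole (ext_part H_part)" "v \<in> whole (ext_part H_part)"
  shows "\<phi> (ext_bracket scale H E u v) = br (\<phi> u) (\<phi> v)"
proof -
  obtain p0 p1 X q0 q1 where u: "u = (p0, p1, X, q0, q1)" "X \<in> whole H_part"
    using assms(1) unfolding whole_ext by blast
  obtain r0 r1 Y t0 t1 where v: "v = (r0, r1, Y, t0, t1)" "Y \<in> whole H_part"
    using assms(2) unfolding whole_ext by blast
  have "\<phi> (ext_bracket scale H E u v) = br X Y + scale q0 (br e0 Y) - scale t0 (br e0 X)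
    + scale q1 (br e1 Y) - scale t1 (br e1 (parity_inv H_part X))
    + scale (q0 * t1 - q1 * t0) (br e0 e1) + scale (q1 * t1) (br e1 e1)"
    unfolding u(1) v(1) ext_bracket.simps \<phi>_add \<phi>_diff \<phi>_scale
    using \<phi>_brackets[OF u(2) v(2)] \<phi>_brackets[OF v(2) u(2)] \<phi>_brackets[OF parity_inv_whole[OF u(2)] v(2)]
    by (simp add: br_e0_e1 br_e1_e1)
  also have "\<dots> = br (\<phi> u) (\<phi> v)"
    unfolding u(1) v(1)
    by (simp add: br_linear br_H_e0[OF u(2)] br_H_e1[OF u(2)] br_e0_e0 br_e1_e0
        scale_left_diff_distrib scale_right_distrib algebra_simps)
  finally show ?thesis .
qed

lemma \<phi>_form:
  assumes "u \<in> whole (ext_part H_part)" "v \<in> whole (ext_part H_part)"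
  shows "ext_form H u v = B (\<phi> u) (\<phi> v)"
  using assms unfolding whole_ext by (auto simp: B_linear algebra_simps)

lemma \<phi>_delta:
  assumes "u \<in> whole (ext_part H_part)"
  shows "\<phi> (ext_delta scale H H_\<delta> E u) = \<delta> (\<phi> u)" "ext_delta scale H H_\<delta> E u \<in> whole (ext_part H_part)"
proof -
  obtain p0 p1 X q0 q1 where u: "u = (p0, p1, X, q0, q1)" "X \<in> whole H_part"
    using assms unfolding whole_ext by blast
  show "\<phi> (ext_delta scale H H_\<delta> E u) = \<delta> (\<phi> u)"
    unfolding u(1) using \<delta>_H[OF u(2)] u(2)
    by (simp add: \<delta>_linear \<delta>_f0 \<delta>_f1 \<delta>_e0 \<delta>_e1 scale_left_distrib scale_right_distrib
        scale_right_diff_distrib algebra_simps)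
  show "ext_delta scale H H_\<delta> E u \<in> whole (ext_part H_part)"
    unfolding u(1) whole_ext by (simp add: H_add H_scale H_\<delta>_whole)
qed

text \<open>
  Stated for every \<open>G\<close> that agrees with the globally bilinear maps on \<open>V\<close>, because the superalgebra
  from which these maps are derived is of this kind.
\<close>

lemma \<phi>_isomorphism:
  assumes "part G = V"
    and "\<And>x y. x \<in> whole V \<Longrightarrow> y \<in> whole V \<Longrightarrow>
      bracket G x y = br x y \<and> bform G x y = B x y \<and> sform G x y = \<omega> x y"
  shows "qs_isomorphism (ext_scale scale) (gen_odd_double_extension scale H H_\<delta> E) scale G \<phi>"
proof -
  have \<phi>_whole: "\<phi> u \<in> whole V" if "u \<in> whole (ext_part H_part)" for u
    using \<phi>_bij that unfolding bij_betw_def by blast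
  show ?thesis
    unfolding qs_isomorphism_def gen_odd_double_extension_def
    using \<phi>_bij \<phi>_part assms \<phi>_whole
    by (simp add: linear_on_def \<phi>_add \<phi>_scale \<phi>_bracket \<phi>_form \<phi>_delta B_\<delta>)
qed

lemma H_double_extension_step:
  assumes "part G = V"
    and "\<And>x y. x \<in> whole V \<Longrightarrow> y \<in> whole V \<Longrightarrow>
      bracket G x y = br x y \<and> bform G x y = B x y \<and> sform G x y = \<omega> x y"
  shows "double_extension_step scale H G"
  unfolding double_extension_step_def
  using H_odd_quadratic_even_symplectic H_associated E_admissible \<phi>_isomorphism[OF assms] by blast

lemma H_null:
  assumes "whole H_part = {0}"
  shows "H = null_superalgebra"
proof -
  have "H_part a = {0}" for a
    using assms H_part_whole[of _ a] subspace_0[OF subspace_H_part, of a] by blast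
  then have "H_part = (\<lambda>a. {0})" by blast
  then show ?thesis
    unfolding H_def null_superalgebra_def assms by (auto simp: fun_eq_iff H_br_def proj_linear B_linear \<omega>_linear)
qed

text \<open>
  The dimension drops, which is measured by independent sets: any such set in \<open>H\<close> can be enlarged by
  \<open>f0\<close>, because \<open>B f0 e1 \<noteq> 0\<close>.
\<close>

lemma independent_insert_f0:
  assumes "independent A" "A \<subseteq> whole H_part"
  shows "independent (insert f0 A)" "f0 \<notin> A"
proof -
  have "f0 \<notin> whole H_part" using B_f0_e1 whole_H_part by auto
  then have "f0 \<notin> span A" using span_minimal[OF assms(2) subspace_whole_H] by blast
  then show "independent (insert f0 A)" using assms(1) by (rule independent_insertI)
  from \<open>f0 \<notin> span A\<close> show "f0 \<notin> A" using span_base by blast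
qed

end


section \<open>Induction on the dimension\<close>

context total_odd_quadratic_symplectic
begin

lemma exists_dual_vector:
  assumes f: "f \<in> V a" "f \<noteq> 0"
  shows "\<exists>e\<in>V (a + 1). B f e = 1"
proof -
  have "\<exists>c y. y \<in> V c \<and> B f y \<noteq> 0"
    using B_eqI[of f 0] f part_whole by (auto simp: B_linear)
  then obtain c y where y: "y \<in> V c" "B f y \<noteq> 0" by blast
  have "c \<noteq> a" using B_odd[OF f(1)] y by blast
  then have "c = a + 1" by (cases a; cases c) auto
  then show ?thesis using y by (intro bexI[of _ "scale (1 / B f y) y"]) (auto simp: B_linear intro: part_scale)
qed

lemma exists_split:
  assumes "whole V \<noteq> {0}"
  shows "\<exists>f0 f1 e0 e1 lam. split_odd_quadratic_symplectic scale V br P B \<omega> f0 f1 e0 e1 lam"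
proof -
  obtain f0 lam where f0: "f0 \<in> V 0" "f0 \<noteq> 0" "lam \<noteq> 0" "\<And>y. br y f0 = 0"
    "\<delta> (\<delta> f0) = scale (lam * lam) f0"
    using exists_central_eigenvector[OF assms] by blast
  define f1 where "f1 = scale (1 / lam) (\<delta> f0)"
  have f1: "f1 \<in> V 1" using \<delta>_graded[OF f0(1)] by (auto simp: f1_def intro: part_scale)
  have \<delta>f0: "\<delta> f0 = scale lam f1" using f0(3) by (simp add: f1_def)
  have \<delta>f1: "\<delta> f1 = scale lam f0" using f0(3,5) by (simp add: f1_def \<delta>_linear)
  have brf1: "br y f1 = 0" for y using \<delta>_central[OF f0(4)] by (simp add: f1_def br_linear)
  have "f1 \<noteq> 0" using \<delta>f1 f0(2,3) by (auto simp: \<delta>_linear)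
  obtain e1 where e1: "e1 \<in> V 1" "B f0 e1 = 1" using exists_dual_vector[OF f0(1,2)] by auto
  obtain e where e: "e \<in> V 0" "B f1 e = 1" using exists_dual_vector[OF f1 \<open>f1 \<noteq> 0\<close>] by auto
  have \<omega>00: "\<omega> f0 f0 = 0" using \<omega>_skew[OF f0(1) f0(1)] by (intro eq_minus_self_zero) simp
  have "B f1 f0 = 0" using \<omega>00 f0(3) by (simp add: B_\<delta>[symmetric] \<delta>f0 B_linear)
  \<comment> \<open>The correction makes \<open>e0\<close> orthogonal to \<open>e1\<close> and keeps its pairing with \<open>f1\<close>.\<close>
  define e0 where "e0 = e - scale (B e e1) f0"
  have "e0 \<in> V 0" using e f0 by (auto simp: e0_def intro: part_diff part_scale)
  moreover have "B f1 e0 = 1" "B e0 e1 = 0" using e e1 \<open>B f1 f0 = 0\<close> by (simp_all add: e0_def B_linear)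
  ultimately have "split_odd_quadratic_symplectic scale V br P B \<omega> f0 f1 e0 e1 lam"
    using f0 f1 e1 brf1 \<delta>f0 \<delta>f1 by unfold_locales auto
  then show ?thesis by blast
qed

end


text \<open>
  Precomposing with a linear projection onto the superalgebra changes none of the values that
  matter.
\<close>

lemma exists_total_structure:
  fixes scale :: "'k::{alg_closed_field, field_char_0} \<Rightarrow> 'v::ab_group_add \<Rightarrow> 'v"
  assumes "odd_quadratic_even_symplectic scale G"
  shows "\<exists>br P B \<omega>. total_odd_quadratic_symplectic scale (part G) br P B \<omega>
    \<and> (\<forall>x\<in>whole (part G). \<forall>y\<in>whole (part G).
        bracket G x y = br x y \<and> bform G x y = B x y \<and> sform G x y = \<omega> x y)"
proof -
  interpret G: lie_superalgebra scale "part G" "bracket G"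
    using assms unfolding odd_quadratic_even_symplectic_def by blast
  obtain P where P: "Vector_Spaces.linear scale scale P" "\<And>x. P x \<in> whole (part G)"
    "\<And>x. x \<in> whole (part G) \<Longrightarrow> P x = x"
    using G.subspace_projection[OF G.subspace_whole] by blast
  interpret P: Vector_Spaces.linear scale scale P by (rule P(1))
  define br where "br x y = bracket G (P x) (P y)" for x y
  define B where "B x y = bform G (P x) (P y)" for x y
  define \<omega> where "\<omega> x y = sform G (P x) (P y)" for x y
  have agree: "bracket G x y = br x y" "bform G x y = B x y" "sform G x y = \<omega> x y"
    if "x \<in> whole (part G)" "y \<in> whole (part G)" for x y
    using that P(3) by (simp_all add: br_def B_def \<omega>_def)
  have PP: "P (P x) = P x" for x using P by simp
  have part: "x \<in> part G a \<Longrightarrow> P x = x" for x a using P(3) G.part_whole by blast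
  have br_whole: "bracket G x y \<in> whole (part G)" if "x \<in> part G a" "y \<in> part G b" for x y a b
    using G.br_graded[OF that] G.part_whole by blast
  have br_whole': "bracket G x y \<in> whole (part G)" if x: "x \<in> whole (part G)" and y: "y \<in> whole (part G)" for x y
  proof -
    obtain x0 x1 where x': "x = x0 + x1" "x0 \<in> part G 0" "x1 \<in> part G 1" using x by (rule G.wholeE)
    obtain y0 y1 where y': "y = y0 + y1" "y0 \<in> part G 0" "y1 \<in> part G 1" using y by (rule G.wholeE)
    have "bracket G x y = bracket G x0 y0 + bracket G x0 y1 + (bracket G x1 y0 + bracket G x1 y1)"
      using G.br_bilinear x y x' y' G.part_whole unfolding bilinear_on_def linear_on_def
      by (metis (no_types, lifting))
    then show ?thesis using br_whole x' y' by (auto intro!: G.whole_add)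
  qed
  have "total_odd_quadratic_symplectic scale (part G) br P B \<omega>"
  proof unfold_locales
    show "bilinear_on scale scale (whole (part G)) br"
      using G.br_bilinear unfolding bilinear_on_def linear_on_def
      by (simp add: br_def P(3) G.whole_add G.whole_scale)
    show "br x y \<in> part G (a + b)" if "x \<in> part G a" "y \<in> part G b" for x y a b
      using G.br_graded[OF that] that by (simp add: br_def part)
    show "br x y = - scale (msgn (a * b)) (br y x)" if "x \<in> part G a" "y \<in> part G b" for x y a b
      using G.br_skew[OF that] that by (simp add: br_def part)
    show "scale (msgn (a * c)) (br x (br y z)) + scale (msgn (a * b)) (br y (br z x))
        + scale (msgn (b * c)) (br z (br x y)) = 0"
      if "x \<in> part G a" "y \<in> part G b" "z \<in> part G c" for x y z a b c
      using G.br_jacobi[OF that] that br_whole by (simp add: br_def part P(3))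
    have bilin: "bilinear_form scale (part G) (\<lambda>x y. \<theta> (P x) (P y))" if "bilinear_form scale (part G) \<theta>" for \<theta>
      using that unfolding bilinear_form_def bilinear_on_def linear_on_def
      by (simp add: P(3) G.whole_add G.whole_scale)
    have nondeg: "nondegenerate (part G) (\<lambda>x y. \<theta> (P x) (P y))" if "nondegenerate (part G) \<theta>" for \<theta> :: "'v \<Rightarrow> 'v \<Rightarrow> 'k"
      using that unfolding nondegenerate_def by (simp add: P(3))
    show "odd_invariant_scalar_product scale (part G) br B"
      unfolding odd_invariant_scalar_product_def
    proof (intro conjI)
      have G: "odd_invariant_scalar_product scale (part G) (bracket G) (bform G)"
        using assms unfolding odd_quadratic_even_symplectic_def by blast
      note G = G[unfolded odd_invariant_scalar_product_def]
      show "bilinear_form scale (part G) B" "nondegenerate (part G) B"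
        using bilin nondeg G unfolding B_def by blast+
      show "odd_form (part G) B"
        unfolding odd_form_def
      proof (intro allI ballI)
        fix a x y assume x: "x \<in> part G a" and y: "y \<in> part G a"
        then show "B x y = 0" using G unfolding odd_form_def B_def part[OF x] part[OF y]
          by blast
      qed
      show "supersymmetric (part G) B"
        unfolding supersymmetric_def
      proof (intro allI ballI)
        fix a b x y assume x: "x \<in> part G a" and y: "y \<in> part G b"
        then show "B x y = msgn (a * b) * B y x" using G unfolding supersymmetric_def B_def part[OF x] part[OF y]
          by blast
      qed
      show "invariant_form (part G) br B"
        unfolding invariant_form_def
      proof (intro ballI)
        fix x y z assume "x \<in> whole (part G)" "y \<in> whole (part G)" "z \<in> whole (part G)"
        then show "B (br x y) z = B x (br y z)" using G br_whole' unfolding invariant_form_def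
          by (simp add: B_def br_def P(3))
      qed
    qed
    show "even_symplectic_form scale (part G) br \<omega>"
      unfolding even_symplectic_form_def
    proof (intro conjI)
      have G: "even_symplectic_form scale (part G) (bracket G) (sform G)"
        using assms unfolding odd_quadratic_even_symplectic_def by blast
      note G = G[unfolded even_symplectic_form_def]
      show "bilinear_form scale (part G) \<omega>" "nondegenerate (part G) \<omega>"
        using bilin nondeg G unfolding \<omega>_def by blast+
      show "even_form (part G) \<omega>"
        unfolding even_form_def
      proof (intro allI impI ballI)
        fix a b x y assume "a \<noteq> b" and x: "x \<in> part G a" and y: "y \<in> part G b"
        then show "\<omega> x y = 0" using G unfolding even_form_def \<omega>_def part[OF x] part[OF y]
          by blast
      qed
      show "skew_supersymmetric (part G) \<omega>"
        unfolding skew_supersymmetric_def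
      proof (intro allI ballI)
        fix a b x y assume x: "x \<in> part G a" and y: "y \<in> part G b"
        then show "\<omega> x y = - (msgn (a * b) * \<omega> y x)" using G unfolding skew_supersymmetric_def \<omega>_def part[OF x] part[OF y]
          by blast
      qed
      show "closed_form (part G) br \<omega>"
        unfolding closed_form_def
      proof (intro allI ballI)
        fix a b c x y z assume x: "x \<in> part G a" and y: "y \<in> part G b" and z: "z \<in> part G c"
        then have "msgn (c * a) * sform G x (bracket G y z) + msgn (a * b) * sform G y (bracket G z x)
            + msgn (b * c) * sform G z (bracket G x y) = 0"
          using G unfolding closed_form_def by blast
        then show "msgn (c * a) * \<omega> x (br y z) + msgn (a * b) * \<omega> y (br z x) + msgn (b * c) * \<omega> z (br x y) = 0"
          unfolding \<omega>_def br_def part[OF x] part[OF y] part[OF z]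
            P(3)[OF br_whole[OF y z]] P(3)[OF br_whole[OF z x]] P(3)[OF br_whole[OF x y]] .
      qed
    qed
  qed (use P(2,3) PP in \<open>simp_all add: br_def B_def \<omega>_def P.add P.scale\<close>)
  then show ?thesis using agree by blast
qed

text \<open>
  The vector \<open>f\<close> witnesses that \<open>H\<close> has smaller dimension than \<open>G\<close>.
\<close>

lemma exists_smaller_step:
  fixes scale :: "'k::{alg_closed_field, field_char_0} \<Rightarrow> 'v::ab_group_add \<Rightarrow> 'v"
  assumes G: "odd_quadratic_even_symplectic scale G" and ne: "whole (part G) \<noteq> {0}"
  shows "\<exists>H f. double_extension_step scale H G \<and> whole (part H) \<subseteq> whole (part G)
    \<and> (whole (part H) = {0} \<longrightarrow> H = null_superalgebra)
    \<and> f \<in> whole (part G)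
    \<and> (\<forall>A. \<not> module.dependent scale A \<longrightarrow> A \<subseteq> whole (part H)
        \<longrightarrow> f \<notin> A \<and> \<not> module.dependent scale (insert f A))"
proof -
  obtain br P B \<omega> where tot: "total_odd_quadratic_symplectic scale (part G) br P B \<omega>"
    and agree: "\<forall>x\<in>whole (part G). \<forall>y\<in>whole (part G).
        bracket G x y = br x y \<and> bform G x y = B x y \<and> sform G x y = \<omega> x y"
    using exists_total_structure[OF G] by blast
  obtain f0 f1 e0 e1 lam where
    "split_odd_quadratic_symplectic scale (part G) br P B \<omega> f0 f1 e0 e1 lam"
    using total_odd_quadratic_symplectic.exists_split[OF tot ne] by blast
  then interpret S: split_odd_quadratic_symplectic scale "part G" br P B \<omega> f0 f1 e0 e1 lam .
  have "double_extension_step scale S.H G"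
    by (rule S.H_double_extension_step) (use agree in auto)
  then show ?thesis
    using S.H_null S.basis_whole(1) S.independent_insert_f0 S.H_part_whole_in
    by (intro exI[of _ S.H] exI[of _ f0]) auto
qed

lemma step_odd_quadratic: "double_extension_step scale H G \<Longrightarrow> odd_quadratic_even_symplectic scale H"
  unfolding double_extension_step_def by blast

theorem corollary4p9:
  fixes scale :: "'k::{alg_closed_field, field_char_0} \<Rightarrow> 'v::ab_group_add \<Rightarrow> 'v"
    and G :: "('k, 'v) qs_superalgebra"
  assumes "odd_quadratic_even_symplectic scale G"
    and "whole (part G) \<noteq> {0}"
  shows "(double_extension_step scale)\<^sup>+\<^sup>+ null_superalgebra G"
proof -
  interpret G: lie_superalgebra scale "part G" "bracket G"
    using assms(1) unfolding odd_quadratic_even_symplectic_def by blast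
  \<comment> \<open>Induction on a bound \<open>n\<close> for the size of independent sets, that is, on the dimension.\<close>
  have "(double_extension_step scale)\<^sup>+\<^sup>+ null_superalgebra G"
    if "odd_quadratic_even_symplectic scale G" "whole (part G) \<noteq> {0}"
      "\<And>A. G.independent A \<Longrightarrow> A \<subseteq> whole (part G) \<Longrightarrow> finite A \<and> card A \<le> n" for n G
    using that
  proof (induction n arbitrary: G)
    case (0 G)
    obtain H f where "double_extension_step scale H G" "f \<in> whole (part G)"
      "\<And>A. G.independent A \<Longrightarrow> A \<subseteq> whole (part H) \<Longrightarrow> f \<notin> A \<and> G.independent (insert f A)"
      using exists_smaller_step[OF 0(1,2)] by blast
    then have "card {f} \<le> 0" using 0(3)[of "{f}"] G.independent_empty by blast
    then show ?case by simp
  next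
    case (Suc n G)
    obtain H f where H: "double_extension_step scale H G" "whole (part H) \<subseteq> whole (part G)"
      "whole (part H) = {0} \<longrightarrow> H = null_superalgebra" "f \<in> whole (part G)"
      "\<And>A. G.independent A \<Longrightarrow> A \<subseteq> whole (part H) \<Longrightarrow> f \<notin> A \<and> G.independent (insert f A)"
      using exists_smaller_step[OF Suc.prems(1,2)] by blast
    show ?case
    proof (cases "whole (part H) = {0}")
      case True then show ?thesis using H(1,3) by auto
    next
      case False
      have "finite A \<and> card A \<le> n" if A: "G.independent A" "A \<subseteq> whole (part H)" for A
      proof -
        have f: "f \<notin> A" "G.independent (insert f A)" using H(5)[OF A] by auto
        then have "finite (insert f A) \<and> card (insert f A) \<le> Suc n"
          using A(2) H(2,4) by (intro Suc.prems(3)) auto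
        then show ?thesis using f(1) by auto
      qed
      then have "(double_extension_step scale)\<^sup>+\<^sup>+ null_superalgebra H"
        using Suc.IH[OF step_odd_quadratic[OF H(1)] False] by blast
      then show ?thesis using H(1) by (rule tranclp.trancl_into_trancl)
    qed
  qed
  moreover obtain T where "finite T" "whole (part G) \<subseteq> G.span T" using G.finite_dim by blast
  ultimately show ?thesis
    using assms G.card_independent_le by meson
qed

end
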